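(* Let $f\in\mathrm{Pol}(\mathbb C^n,\mathbb C^m)$ and let $C_S$ be a polynomial type algebraic complexity, given by data $\{V_\alpha,\widehat{\mathcal P}_\alpha\}_{\alpha\in\mathcal A}$ as described in the context, with $f\in\bigcup_\alpha\widehat{\mathcal P}_\alpha(V_\alpha)$. Then there exists an algorithm (based on Gröbner bases) that computes $C_S(f)=\min\{\alpha\in\mathcal A:\ f\in\widehat{\mathcal P}_\alpha(V_\alpha)\}$.
   Context: $\mathrm{Pol}^{K}(\mathbb C^n,\mathbb C^m)$ denotes polynomial mappings $\mathbb C^n\to\mathbb C^m$ with components of degree at most $K$, and $\mathrm{Pol}(\mathbb C^n,\mathbb C^m)=\bigcup_K\mathrm{Pol}^K(\mathbb C^n,\mathbb C^m)$, identified via monomial coefficients with finite-dimensional vector spaces. A polynomial type algebraic complexity is specified by an index set $\mathcal A\subset\mathbb N$, finite-dimensional vector spaces $V_\alpha$ ($\alpha\in\mathcal A$) with $V_\alpha\subset V_{\alpha'}$ for $\alpha\le\alpha'$, and polynomial mappings $\widehat{\mathcal P}_\alpha:V_\alpha\to\mathrm{Pol}^{K(\alpha)}(\mathbb C^n,\mathbb C^m)$, $K(\alpha)<\infty$, with $\widehat{\mathcal P}_\alpha(V_\alpha)\subset\widehat{\mathcal P}_\beta(V_\beta)$ for $\alpha\le\beta$ (each $\alpha$-parameter is thought of as encoding a computational model whose output is $\widehat{\mathcal P}_\alpha$ of it); the complexity of $f$ is $C_S(f)=\min\{\alpha:\ f\in\widehat{\mathcal P}_\alpha(V_\alpha)\}$.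 Example: the determinantal complexity, with $V_p$ the space of affine maps $\mathbb C^n\to\mathbb C^{p^2}$ and $\widehat{\mathcal P}_p(A)=A^*\det_p$. *)

theory Defs
  imports Complex_Main "HOL-Library.FuncSet" "Jordan_Normal_Form.Matrix"
begin

section \<open>Polynomial mappings\<close>

text \<open>A polynomial is written down as a finite list of terms, each consisting of an exponent
  vector and a coefficient.  Repeated exponent vectors and zero coefficients are allowed, so that a
  polynomial has many such presentations; the coefficient of a monomial is the sum of the
  coefficients of all its terms.\<close>

type_synonym 'c terms = "(nat list \<times> 'c) list"

definition terms_in :: "nat \<Rightarrow> nat \<Rightarrow> 'c terms \<Rightarrow> bool" where
  "terms_in n K p \<longleftrightarrow> (\<forall>(e, c) \<in> set p. length e = n \<and> sum_list e \<le> K)"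

definition monomial_value :: "nat list \<Rightarrow> complex vec \<Rightarrow> complex" where
  "monomial_value e x = (\<Prod>i<length e. (x $ i) ^ (e ! i))"

definition poly_value :: "complex terms \<Rightarrow> complex vec \<Rightarrow> complex" where
  "poly_value p x = (\<Sum>(e, c) \<leftarrow> p. c * monomial_value e x)"

text \<open>Mappings defined on \<open>\<complex>\<^sup>n\<close> are functions on \<^term>\<open>carrier_vec n\<close> that are undefined elsewhere, so
  that equality of functions is equality of mappings.\<close>

type_synonym cmap = "complex vec \<Rightarrow> complex vec"

definition cmap_of :: "nat \<Rightarrow> complex terms list \<Rightarrow> cmap" where
  "cmap_of n F = (\<lambda>x \<in> carrier_vec n. vec (length F) (\<lambda>j. poly_value (F ! j) x))"

definition presents_cmap :: "nat \<Rightarrow> nat \<Rightarrow> nat \<Rightarrow> complex terms list \<Rightarrow> cmap \<Rightarrow> bool" where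
  "presents_cmap n m K F f \<longleftrightarrow>
     length F = m \<and> (\<forall>p \<in> set F. terms_in n K p) \<and> f = cmap_of n F"

definition Pol_le :: "nat \<Rightarrow> nat \<Rightarrow> nat \<Rightarrow> cmap set" where
  "Pol_le K n m = {f. \<exists>F. presents_cmap n m K F f}"

definition Pol :: "nat \<Rightarrow> nat \<Rightarrow> cmap set" where
  "Pol n m = (\<Union>K. Pol_le K n m)"


section \<open>Polynomial type algebraic complexities\<close>

text \<open>In a family of polynomial mappings depending polynomially on parameters \<open>t \<in> \<complex>\<^sup>d\<close>, the
  coefficient of each term is itself a polynomial in \<open>t\<close>, of arbitrary degree.\<close>

definition specialize :: "complex vec \<Rightarrow> complex terms terms list \<Rightarrow> complex terms list" where
  "specialize t Q = map (map (\<lambda>(e, q). (e, poly_value q t))) Q"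

definition wf_family :: "nat \<Rightarrow> nat \<Rightarrow> nat \<Rightarrow> nat \<Rightarrow> complex terms terms list \<Rightarrow> bool" where
  "wf_family d K n m Q \<longleftrightarrow> length Q = m \<and>
     (\<forall>p \<in> set Q. terms_in n K p \<and> (\<forall>(e, q) \<in> set p. \<exists>L. terms_in d L q))"

locale complex_vector_space = vector_space scale
  for scale :: "complex \<Rightarrow> 'v::ab_group_add \<Rightarrow> 'v"
begin

definition is_basis :: "'v list \<Rightarrow> 'v set \<Rightarrow> bool" where
  "is_basis bs W \<longleftrightarrow> distinct bs \<and> independent (set bs) \<and> span (set bs) = W"

text \<open>\<open>(bs, Q)\<close> expresses \<open>\<Phi> : W \<rightarrow> Pol\<^sup>K(\<complex>\<^sup>n, \<complex>\<^sup>m)\<close> in the coordinates given by the basis \<open>bs\<close> of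
  \<open>W\<close> and by the monomial coefficients on \<open>Pol\<^sup>K(\<complex>\<^sup>n, \<complex>\<^sup>m)\<close>.\<close>

definition presents_family ::
    "nat \<Rightarrow> nat \<Rightarrow> nat \<Rightarrow> 'v set \<Rightarrow> ('v \<Rightarrow> cmap) \<Rightarrow> 'v list \<Rightarrow> complex terms terms list \<Rightarrow> bool"
  where
  "presents_family n m K W \<Phi> bs Q \<longleftrightarrow>
     is_basis bs W \<and> wf_family (length bs) K n m Q \<and>
     (\<forall>t \<in> carrier_vec (length bs).
        \<Phi> (\<Sum>i<length bs. scale (t $ i) (bs ! i)) = cmap_of n (specialize t Q))"

end

text \<open>The spaces \<open>V \<alpha>\<close> are subspaces of one complex vector space, which gives a meaning to the
  inclusions between them.\<close>

locale polynomial_type_complexity = complex_vector_space scale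
  for scale :: "complex \<Rightarrow> 'v::ab_group_add \<Rightarrow> 'v" +
  fixes n m :: nat
    and A :: "nat set"
    and V :: "nat \<Rightarrow> 'v set"
    and K :: "nat \<Rightarrow> nat"
    and P :: "nat \<Rightarrow> 'v \<Rightarrow> cmap"
  assumes subspace_V: "\<alpha> \<in> A \<Longrightarrow> subspace (V \<alpha>)"
    and finite_dim_V: "\<alpha> \<in> A \<Longrightarrow> \<exists>B. finite B \<and> span B = V \<alpha>"
    and V_mono: "\<alpha> \<in> A \<Longrightarrow> \<beta> \<in> A \<Longrightarrow> \<alpha> \<le> \<beta> \<Longrightarrow> V \<alpha> \<subseteq> V \<beta>"
    and P_into: "\<alpha> \<in> A \<Longrightarrow> P \<alpha> ` V \<alpha> \<subseteq> Pol_le (K \<alpha>) n m"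
    and P_polynomial: "\<alpha> \<in> A \<Longrightarrow> \<exists>bs Q. presents_family n m (K \<alpha>) (V \<alpha>) (P \<alpha>) bs Q"
    and image_mono: "\<alpha> \<in> A \<Longrightarrow> \<beta> \<in> A \<Longrightarrow> \<alpha> \<le> \<beta> \<Longrightarrow> P \<alpha> ` V \<alpha> \<subseteq> P \<beta> ` V \<beta>"

definition complexity :: "nat set \<Rightarrow> (nat \<Rightarrow> 'v set) \<Rightarrow> (nat \<Rightarrow> 'v \<Rightarrow> cmap) \<Rightarrow> cmap \<Rightarrow> nat" where
  "complexity A V P f = (LEAST \<alpha>. \<alpha> \<in> A \<and> f \<in> P \<alpha> ` V \<alpha>)"


section \<open>Algorithms over the complex numbers\<close>

text \<open>Algorithms are programs of a while language with exact field arithmetic and equality tests on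
  complex numbers, as in the Blum--Shub--Smale model.  The only built-in constants are 0 and 1.
  Data are binary trees whose leaves are empty or carry a complex number.\<close>

datatype data = Null | Num complex | Node data data

text \<open>Every program transforms one datum into another.  \<open>Fork p q\<close> runs both programs on the same
  input and pairs the results.  In \<open>Cond\<close> and \<open>While\<close> a non-zero number counts as true and zero as
  false.  \<open>Query\<close> asks an external source, indexed by the natural numbers, for a datum.\<close>

datatype prog =
    Skip | Seq prog prog
  | MkNull | MkZero | MkOne
  | Fork prog prog | First | Second | IsNull
  | Add | Sub | Mul | Div
  | Cond prog prog prog | While prog prog
  | Query

text \<open>\<open>run src p x y\<close>: with source \<open>src\<close>, the program \<open>p\<close> started on \<open>x\<close> halts with output \<open>y\<close>.
  A program applied to a datum of the wrong shape, or dividing by zero, gets stuck and has no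
  output.\<close>

inductive run :: "(nat \<Rightarrow> data) \<Rightarrow> prog \<Rightarrow> data \<Rightarrow> data \<Rightarrow> bool" for src where
  Skip: "run src Skip x x"
| Seq: "run src p x y \<Longrightarrow> run src q y z \<Longrightarrow> run src (Seq p q) x z"
| MkNull: "run src MkNull x Null"
| MkZero: "run src MkZero x (Num 0)"
| MkOne: "run src MkOne x (Num 1)"
| Fork: "run src p x y \<Longrightarrow> run src q x z \<Longrightarrow> run src (Fork p q) x (Node y z)"
| First: "run src First (Node x y) x"
| Second: "run src Second (Node x y) y"
| IsNull: "run src IsNull x (Num (if x = Null then 1 else 0))"
| Add: "run src Add (Node (Num a) (Num b)) (Num (a + b))"
| Sub: "run src Sub (Node (Num a) (Num b)) (Num (a - b))"
| Mul: "run src Mul (Node (Num a) (Num b)) (Num (a * b))"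
| Div: "b \<noteq> 0 \<Longrightarrow> run src Div (Node (Num a) (Num b)) (Num (a / b))"
| CondTrue: "run src t x (Num c) \<Longrightarrow> c \<noteq> 0 \<Longrightarrow> run src p x y \<Longrightarrow> run src (Cond t p q) x y"
| CondFalse: "run src t x (Num 0) \<Longrightarrow> run src q x y \<Longrightarrow> run src (Cond t p q) x y"
| WhileTrue: "run src t x (Num c) \<Longrightarrow> c \<noteq> 0 \<Longrightarrow> run src p x y \<Longrightarrow> run src (While t p) y z
    \<Longrightarrow> run src (While t p) x z"
| WhileFalse: "run src t x (Num 0) \<Longrightarrow> run src (While t p) x x"
| Query: "run src Query (Num (of_nat k)) (src k)"

inductive_cases run_SeqE: "run src (Seq p q) x z"
inductive_cases run_ForkE: "run src (Fork p q) x z"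
inductive_cases run_CondE: "run src (Cond t p q) x z"
inductive_cases run_WhileE: "run src (While t p) x z"

lemma run_deterministic: "run src p x y \<Longrightarrow> run src p x z \<Longrightarrow> y = z"
proof (induction arbitrary: z rule: run.induct)
  case (Seq p x y q z z')
  from Seq.prems show ?case by (rule run_SeqE) (use Seq.IH in blast)
next
  case (Fork p x y q z z')
  from Fork.prems show ?case by (rule run_ForkE) (use Fork.IH in blast)
next
  case (CondTrue t x c p y q)
  from CondTrue.prems show ?case
    by (rule run_CondE) (use CondTrue.IH CondTrue.hyps in blast)+
next
  case (CondFalse t x q y p)
  from CondFalse.prems show ?case
    by (rule run_CondE) (use CondFalse.IH in blast)+
next
  case (WhileTrue t x c p y z z')
  from WhileTrue.prems show ?case
    by (rule run_WhileE) (use WhileTrue.IH WhileTrue.hyps in blast)+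
next
  case (WhileFalse t x p)
  from WhileFalse.prems show ?case
    by (rule run_WhileE) (use WhileFalse.IH in blast)+
qed (erule run.cases; simp)+


section \<open>Inputs and outputs\<close>

definition code_nat :: "nat \<Rightarrow> data" where
  "code_nat k = Num (of_nat k)"

definition code_list :: "('a \<Rightarrow> data) \<Rightarrow> 'a list \<Rightarrow> data" where
  "code_list code xs = foldr (\<lambda>x. Node (code x)) xs Null"

definition code_terms :: "('c \<Rightarrow> data) \<Rightarrow> 'c terms \<Rightarrow> data" where
  "code_terms code = code_list (\<lambda>(e, c). Node (code_list code_nat e) (code c))"

definition code_cmap :: "nat \<Rightarrow> nat \<Rightarrow> complex terms list \<Rightarrow> data" where
  "code_cmap n m F = Node (code_nat n) (Node (code_nat m) (code_list (code_terms Num) F))"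

text \<open>The data defining a complexity consist of one finite piece for every \<open>\<alpha> \<in> A\<close>, namely the
  dimension \<open>d \<alpha>\<close> of the parameter space, the degree bound and the coefficients of the
  parametrization.  As \<open>A\<close> may be infinite, a program reads them by queries, which also tell it
  whether a given \<open>\<alpha>\<close> belongs to \<open>A\<close>.\<close>

definition complexity_source ::
    "nat set \<Rightarrow> (nat \<Rightarrow> nat) \<Rightarrow> (nat \<Rightarrow> nat) \<Rightarrow> (nat \<Rightarrow> complex terms terms list) \<Rightarrow> nat \<Rightarrow> data" where
  "complexity_source A d K Q \<alpha> =
     (if \<alpha> \<in> A
      then Node (code_nat (d \<alpha>))
             (Node (code_nat (K \<alpha>)) (code_list (code_terms (code_terms Num)) (Q \<alpha>)))
      else Null)"

end

theory Submission
  imports Defs "HOL-Computational_Algebra.Fundamental_Theorem_Algebra"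
begin

text \<open>Comparing coefficients turns \<open>f \<in> P \<alpha> ` V \<alpha>\<close> into the solvability of a system of polynomial
  equations in the coordinates of the parameter, and the complexity is found by testing
  \<open>\<alpha> = 0, 1, 2, \<dots>\<close> in turn.  Instead of a Groebner basis, solvability is decided by eliminating one
  variable at a time.  As polynomials in the first variable, two equations are combined by a
  pseudo-division step, after branching on whether the leading coefficient of the divisor vanishes;
  this ends with at most one equation \<open>p = 0\<close> and one inequation \<open>g \<noteq> 0\<close> involving the variable.
  By the fundamental theorem of algebra they have a common solution iff \<open>p\<close> does not divide
  \<open>g ^ degree p\<close>, i.e. iff some coefficient of the pseudo-remainder is non-zero.  Leading coefficients
  are never tested for being the zero polynomial, since the branch assuming otherwise is
  unsatisfiable in that case; so polynomials need no normal form, and the number of steps is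
  bounded in advance by the lengths of the coefficient lists.\<close>

section \<open>Computable functions\<close>

text \<open>A single overloaded encoding makes computability a property of the function alone, so
  that it can be derived by rules following the structure of a term.\<close>

class encodable =
  fixes enc :: "'a \<Rightarrow> data"

instantiation nat :: encodable
begin
definition enc_nat where "enc_nat = code_nat"
instance ..
end

instantiation complex :: encodable
begin
definition enc_complex where "enc_complex = Num"
instance ..
end

instantiation bool :: encodable
begin
definition enc_bool where "enc_bool b = Num (if b then 1 else 0)"
instance ..
end

instantiation list :: (encodable) encodable
begin
definition enc_list :: "'a list \<Rightarrow> data" where "enc_list = code_list enc"
instance ..
end

instantiation prod :: (encodable, encodable) encodable
begin
definition enc_prod :: "'a \<times> 'b \<Rightarrow> data" where "enc_prod z = Node (enc (fst z)) (enc (snd z))"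
instance ..
end

lemma enc_simps [simp]:
  "enc (k :: nat) = Num (of_nat k)"
  "enc (c :: complex) = Num c"
  "enc ([] :: 'a::encodable list) = Null"
  "enc (y # ys :: 'a list) = Node (enc y) (enc ys)"
  "enc (a :: 'a, b :: 'b::encodable) = Node (enc a) (enc b)"
  by (simp_all add: enc_nat_def code_nat_def enc_complex_def enc_list_def code_list_def
      enc_prod_def)

lemma enc_bool [simp]: "enc b = Num (if b then 1 else 0)"
  by (simp add: enc_bool_def)

text \<open>One program has to serve all sources, so it can be embedded in the final search whatever
  data are queried there.\<close>

definition computable :: "('a::encodable \<Rightarrow> 'b::encodable) \<Rightarrow> bool" where
  "computable f \<longleftrightarrow> (\<exists>p. \<forall>src x. run src p (enc x) (enc (f x)))"

lemma computableE:
  assumes "computable f"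
  obtains p where "\<And>src x. run src p (enc x) (enc (f x))"
  using assms unfolding computable_def by blast

lemma computableI: "(\<And>src x. run src p (enc x) (enc (f x))) \<Longrightarrow> computable f"
  unfolding computable_def by blast

lemma computable_cong: "computable g \<Longrightarrow> (\<And>x. g x = f x) \<Longrightarrow> computable f"
  unfolding computable_def by simp

named_theorems computable_intros

lemma computable_id [computable_intros]: "computable (\<lambda>x. x)"
  by (rule computableI, rule run.Skip)

lemma computable_compose: "computable f \<Longrightarrow> computable g \<Longrightarrow> computable (\<lambda>x. f (g x))"
  by (elim computableE) (rule computableI, rule run.Seq)

lemma computable_Pair [computable_intros]:
  "computable f \<Longrightarrow> computable g \<Longrightarrow> computable (\<lambda>x. (f x, g x))"
  by (elim computableE) (rule computableI, unfold enc_simps, rule run.Fork)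

text \<open>Functions of several arguments are treated as functions of a tuple. Once the arguments
  are projections, their occurrences below \<open>map\<close> or \<open>foldl\<close> are again
  projections of the extended context, and the introduction rules apply directly; the definitions
  below are unfolded in this form.\<close>

lemma computable_compose2:
  assumes "computable (\<lambda>z. f (fst z) (snd z))" "computable a" "computable b"
  shows "computable (\<lambda>x. f (a x) (b x))"
  using computable_compose[OF assms(1) computable_Pair[OF assms(2,3)]] by simp

lemma computable_compose3:
  assumes "computable (\<lambda>z. f (fst z) (fst (snd z)) (snd (snd z)))"
    "computable a" "computable b" "computable c"
  shows "computable (\<lambda>x. f (a x) (b x) (c x))"
  using computable_compose[OF assms(1) computable_Pair[OF assms(2) computable_Pair[OF assms(3,4)]]]
  by simp

lemma computable_fst [computable_intros]: "computable f \<Longrightarrow> computable (\<lambda>x. fst (f x))"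
  by (rule computable_compose[of fst], rule computableI[of First])
    (simp add: enc_prod_def run.First)

lemma computable_snd [computable_intros]: "computable f \<Longrightarrow> computable (\<lambda>x. snd (f x))"
  by (rule computable_compose[of snd], rule computableI[of Second])
    (simp add: enc_prod_def run.Second)

lemma computable_case_prod [computable_intros]:
  "computable (\<lambda>x. f x (fst (p x)) (snd (p x))) \<Longrightarrow>
   computable (\<lambda>x. case p x of (a, b) \<Rightarrow> f x a b)"
  by (simp add: split_def)

lemma computable_consts [computable_intros]:
  "computable (\<lambda>x. 0 :: nat)" "computable (\<lambda>x. 1 :: nat)"
  "computable (\<lambda>x. 0 :: complex)" "computable (\<lambda>x. 1 :: complex)"
  "computable (\<lambda>x. True)" "computable (\<lambda>x. False)"
  "computable (\<lambda>x. [] :: 'a::encodable list)"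
  by (rule computableI[of MkZero] computableI[of MkOne] computableI[of MkNull],
      simp add: run.MkZero run.MkOne run.MkNull)+

lemma computable_Cons [computable_intros]:
  "computable f \<Longrightarrow> computable g \<Longrightarrow> computable (\<lambda>x. f x # g x)"
  by (elim computableE) (rule computableI, unfold enc_simps, rule run.Fork)

lemma computable_arith [computable_intros]:
  fixes f g :: "'a::encodable \<Rightarrow> complex" and j k :: "'a \<Rightarrow> nat"
  shows "computable f \<Longrightarrow> computable g \<Longrightarrow> computable (\<lambda>x. f x + g x)"
    "computable f \<Longrightarrow> computable g \<Longrightarrow> computable (\<lambda>x. f x - g x)"
    "computable f \<Longrightarrow> computable g \<Longrightarrow> computable (\<lambda>x. f x * g x)"
    "computable j \<Longrightarrow> computable k \<Longrightarrow> computable (\<lambda>x. j x + k x)"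
  by (erule computable_compose2[rotated], assumption,
      rule computableI[of Add] computableI[of Sub] computableI[of Mul],
      simp add: enc_prod_def run.Add run.Sub run.Mul)+

lemma computable_If [computable_intros]:
  assumes "computable b" "computable f" "computable g"
  shows "computable (\<lambda>x. if b x then f x else g x)"
proof -
  obtain pb pf pg where p: "\<And>src x. run src pb (enc x) (enc (b x))"
    "\<And>src x. run src pf (enc x) (enc (f x))" "\<And>src x. run src pg (enc x) (enc (g x))"
    using assms by (elim computableE) blast
  have "run src (Cond pb pf pg) (enc x) (enc (if b x then f x else g x))" for src x
    using p(1)[of src x] p(2,3) by (cases "b x") (auto intro: run.CondTrue run.CondFalse)
  then show ?thesis by (rule computableI)
qed

lemma computable_Not [computable_intros]: "computable b \<Longrightarrow> computable (\<lambda>x. \<not> b x)"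
  by (rule computable_cong[OF computable_If[of b "\<lambda>_. False" "\<lambda>_. True"]])
    (simp_all add: computable_consts)

lemma computable_conj [computable_intros]:
  "computable b \<Longrightarrow> computable c \<Longrightarrow> computable (\<lambda>x. b x \<and> c x)"
  by (rule computable_cong[OF computable_If[of b c "\<lambda>_. False"]])
    (simp_all add: computable_consts)

lemma computable_eq_0 [computable_intros]:
  fixes f :: "'a::encodable \<Rightarrow> complex" and k :: "'a \<Rightarrow> nat"
  shows "computable f \<Longrightarrow> computable (\<lambda>x. f x = 0)"
    and "computable k \<Longrightarrow> computable (\<lambda>x. k x = 0)"
proof -
  \<comment> \<open>The number itself serves as truth value. The instance at \<open>of_nat\<close>
    covers natural numbers, which are encoded as complex ones.\<close>
  have "run src (Cond Skip MkZero MkOne) (Num c) (enc (c = 0))" for src c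
    by (cases "c = 0") (auto intro: run.intros)
  from this this[of _ "of_nat _"]
  have 1: "computable (\<lambda>c. c = (0 :: complex))" and 2: "computable (\<lambda>k. k = (0 :: nat))"
    by (auto intro!: computableI[of "Cond Skip MkZero MkOne"])
  show "computable f \<Longrightarrow> computable (\<lambda>x. f x = 0)"
    and "computable k \<Longrightarrow> computable (\<lambda>x. k x = 0)"
    by (rule computable_compose[OF 1] computable_compose[OF 2], assumption)+
qed

lemma computable_case_list [computable_intros]:
  assumes "computable xs" "computable a"
    "computable (\<lambda>z. b (fst z) (fst (snd z)) (snd (snd z)))"
  shows "computable (\<lambda>x. case xs x of [] \<Rightarrow> a x | y # ys \<Rightarrow> b x y ys)"
proof -
  obtain p pa pb where p: "\<And>src x. run src p (enc x) (enc (xs x))"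
    "\<And>src x. run src pa (enc x) (enc (a x))"
    "\<And>src z. run src pb (enc z) (enc (b (fst z) (fst (snd z)) (snd (snd z))))"
    using assms by (elim computableE) blast
  \<comment> \<open>The encodings of \<open>(x, y # ys)\<close> and \<open>(x, y, ys)\<close>
    coincide, so pairing the input with a non-empty list yields exactly the argument expected by
    \<open>pb\<close>.\<close>
  have "run src (Cond (Seq p IsNull) pa (Seq (Fork Skip p) pb)) (enc x)
      (enc (case xs x of [] \<Rightarrow> a x | y # ys \<Rightarrow> b x y ys))" for src x
  proof (cases "xs x")
    case Nil
    have "run src (Seq p IsNull) (enc x) (Num 1)"
      using run.Seq[OF p(1)[of src x] run.IsNull] Nil by simp
    then show ?thesis
      using Nil p(2) by (auto intro: run.CondTrue)
  next
    case (Cons y ys)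
    have "run src (Seq p IsNull) (enc x) (Num 0)"
      using run.Seq[OF p(1)[of src x] run.IsNull] Cons by simp
    moreover have "run src (Seq (Fork Skip p) pb) (enc x) (enc (b x y ys))"
      using run.Seq[OF run.Fork[OF run.Skip p(1)[of src x]]] p(3)[of src "(x, y, ys)"] Cons by simp
    ultimately show ?thesis
      using Cons by (auto intro: run.CondFalse)
  qed
  then show ?thesis by (rule computableI)
qed

section \<open>While loops and iteration\<close>

lemma computable_loop:
  fixes \<mu> :: "'a::encodable \<Rightarrow> nat"
  assumes "computable b" "computable s"
    and decr: "\<And>x. b x \<Longrightarrow> \<mu> (s x) < \<mu> x"
    and inv: "\<And>x. b x \<Longrightarrow> r (s x) = r x"
    and final: "\<And>x. \<not> b x \<Longrightarrow> r x = x"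
  shows "computable r"
proof -
  obtain pb ps where p: "\<And>src x. run src pb (enc x) (enc (b x))"
    "\<And>src x. run src ps (enc x) (enc (s x))"
    using assms(1,2) by (elim computableE) blast
  \<comment> \<open>Here \<open>r\<close> is the final state as a function of the current one: a
    round leaves it unchanged, and it is the identity where the loop stops.\<close>
  have "run src (While pb ps) (enc x) (enc (r x))" for src x
  proof (induction x rule: measure_induct_rule[of \<mu>])
    case (less x)
    show ?case
    proof (cases "b x")
      case True
      have "run src (While pb ps) (enc (s x)) (enc (r x))"
        using less[OF decr[OF True]] inv[OF True] by simp
      then show ?thesis
        using run.WhileTrue[OF _ _ p(2)] p(1)[of src x] True by auto
    next
      case False
      then show ?thesis
        using run.WhileFalse[of src pb "enc x" ps] p(1)[of src x] final by simp
    qed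
  qed
  then show ?thesis by (rule computableI)
qed

lemma computable_pred [computable_intros]:
  "computable k \<Longrightarrow> computable (\<lambda>x. k x - (1 :: nat))"
proof (rule computable_compose[of "\<lambda>k. k - 1"])
  \<comment> \<open>Complex subtraction would turn 0 into -1, so zero is branched off to obtain the
    truncated predecessor.\<close>
  have "run src (Cond Skip (Seq (Fork Skip MkOne) Sub) MkZero) (Num (of_nat k))
      (Num (of_nat (k - 1)))" for src k
  proof (cases k)
    case (Suc j)
    have "run src (Seq (Fork Skip MkOne) Sub) (Num (of_nat k)) (Num (of_nat k - 1))"
      by (rule run.Seq[OF run.Fork[OF run.Skip run.MkOne] run.Sub])
    then have "run src (Cond Skip (Seq (Fork Skip MkOne) Sub) MkZero) (Num (of_nat k))
        (Num (of_nat k - 1))"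
      by (intro run.CondTrue[OF run.Skip]) (use Suc in \<open>simp_all del: of_nat_Suc\<close>)
    then show ?thesis
      using Suc by simp
  qed (auto intro: run.intros)
  then show "computable (\<lambda>k. k - (1 :: nat))"
    by (intro computableI) simp
qed

lemma computable_Suc [computable_intros]: "computable k \<Longrightarrow> computable (\<lambda>x. Suc (k x))"
  unfolding Suc_eq_plus1 by (intro computable_intros)

lemma computable_funpow [computable_intros]:
  fixes h :: "'a::encodable \<Rightarrow> 'b::encodable \<Rightarrow> 'b"
  assumes "computable (\<lambda>z. h (fst z) (snd z))" "computable k" "computable i"
  shows "computable (\<lambda>x. (h x ^^ k x) (i x))"
proof -
  \<comment> \<open>The loop state consists of context, accumulator and counter. The result has
    counter 0 because \<open>computable_loop\<close> needs \<open>r\<close> to fix the states where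
    the loop stops.\<close>
  define r where "r = (\<lambda>(x, a, n). (x, (h x ^^ n) a, 0 :: nat))"
  have h: "computable (\<lambda>z. h (fst z) (fst (snd z)))"
    by (rule computable_compose2[OF assms(1)]) (intro computable_intros)+
  define s where "s = (\<lambda>z. (fst z, h (fst z) (fst (snd z)), snd (snd z) - (1 :: nat)))"
  have s: "computable s"
    unfolding s_def by (intro computable_intros h)
  have b: "computable (\<lambda>z :: 'a \<times> 'b \<times> nat. snd (snd z) \<noteq> 0)"
    by (intro computable_intros)
  have r: "computable r"
  proof (rule computable_loop[OF b s, where \<mu> = "\<lambda>z. snd (snd z)"])
    show "r (s z) = r z" if "snd (snd z) \<noteq> 0" for z
      using that by (cases "snd (snd z)") (auto simp: r_def s_def split_def funpow_swap1)
  qed (auto simp: r_def s_def)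
  have "computable (\<lambda>x. fst (snd (r (x, i x, k x))))"
    by (intro computable_intros computable_compose[OF r] assms)
  then show ?thesis
    by (simp add: r_def)
qed

lemma computable_foldl [computable_intros]:
  fixes h :: "'a::encodable \<Rightarrow> 'b::encodable \<Rightarrow> 'c::encodable \<Rightarrow> 'b"
  assumes "computable (\<lambda>z. h (fst z) (fst (snd z)) (snd (snd z)))" "computable i" "computable ys"
  shows "computable (\<lambda>x. foldl (h x) (i x) (ys x))"
proof -
  define r where "r = (\<lambda>(x, a, ys). (x, foldl (h x) a ys, [] :: 'c list))"
  define s where "s = (\<lambda>z. case snd (snd z) of [] \<Rightarrow> z | y # ys \<Rightarrow> (fst z, h (fst z) (fst (snd z)) y, ys))"
  have "computable (\<lambda>z. h (fst (fst z)) (fst (snd (fst z))) (fst (snd z)))"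
    by (rule computable_compose3[OF assms(1)]) (intro computable_intros)+
  then have s: "computable s"
    unfolding s_def by (intro computable_intros)
  have b: "computable (\<lambda>z. case snd (snd z) of [] \<Rightarrow> False | _ \<Rightarrow> True)"
    by (intro computable_intros)
  have r: "computable r"
    by (rule computable_loop[OF b s, where \<mu> = "\<lambda>z. length (snd (snd z))"])
      (auto simp: r_def s_def split: list.splits)
  have "computable (\<lambda>x. fst (snd (r (x, i x, ys x))))"
    by (intro computable_intros computable_compose[OF r] assms)
  then show ?thesis
    by (simp add: r_def)
qed

subsection \<open>List functions\<close>

lemma computable_rev [computable_intros]: "computable xs \<Longrightarrow> computable (\<lambda>x. rev (xs x))"
proof -
  have "rev xs = foldl (\<lambda>a y. y # a) [] xs" for xs :: "'b list"
    by (induction xs rule: rev_induct) auto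
  then show "computable xs \<Longrightarrow> computable (\<lambda>x. rev (xs x))"
    by simp (intro computable_intros)
qed

lemma computable_foldr [computable_intros]:
  assumes "computable (\<lambda>z. h (fst z) (fst (snd z)) (snd (snd z)))" "computable i" "computable ys"
  shows "computable (\<lambda>x. foldr (h x) (ys x) (i x))"
  unfolding foldr_conv_foldl
  by (intro computable_intros assms computable_compose3[OF assms(1)])

lemma computable_append [computable_intros]:
  assumes "computable f" "computable g"
  shows "computable (\<lambda>x. f x @ g x)"
proof (rule computable_cong)
  show "computable (\<lambda>x. foldr (#) (f x) (g x))"
    by (intro computable_intros assms)
  have "foldr (#) xs ys = xs @ ys" for xs ys :: "'b list"
    by (induction xs) auto
  then show "foldr (#) (f x) (g x) = f x @ g x" for x .
qed

lemma computable_map [computable_intros]: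
  assumes "computable (\<lambda>z. h (fst z) (snd z))" "computable xs"
  shows "computable (\<lambda>x. map (h x) (xs x))"
proof -
  have "map h xs = foldr (\<lambda>y. (#) (h y)) xs []" for h :: "'b \<Rightarrow> 'c" and xs
    by (induction xs) auto
  then show ?thesis
    by simp (intro computable_intros assms computable_compose2[OF assms(1)])
qed

lemma computable_filter [computable_intros]:
  assumes "computable (\<lambda>z. h (fst z) (snd z))" "computable xs"
  shows "computable (\<lambda>x. filter (h x) (xs x))"
proof -
  have "filter h xs = foldr (\<lambda>y a. if h y then y # a else a) xs []" for h :: "'b \<Rightarrow> bool" and xs
    by (induction xs) auto
  then show ?thesis
    by simp (intro computable_intros assms computable_compose2[OF assms(1)])
qed

lemma computable_concat [computable_intros]:
  "computable xs \<Longrightarrow> computable (\<lambda>x. concat (xs x))"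
  unfolding concat_conv_foldr by (intro computable_intros)

lemma computable_list_all [computable_intros]:
  assumes "computable (\<lambda>z. h (fst z) (snd z))" "computable xs"
  shows "computable (\<lambda>x. list_all (h x) (xs x))"
proof -
  have "list_all h xs = (case filter (\<lambda>y. \<not> h y) xs of [] \<Rightarrow> True | _ \<Rightarrow> False)"
    for h :: "'b \<Rightarrow> bool" and xs
    by (induction xs) auto
  then show ?thesis
    using assms by simp (intro computable_intros)
qed

lemma computable_list_ex [computable_intros]:
  assumes "computable (\<lambda>z. h (fst z) (snd z))" "computable xs"
  shows "computable (\<lambda>x. list_ex (h x) (xs x))"
proof (rule computable_cong)
  show "computable (\<lambda>x. \<not> list_all (\<lambda>y. \<not> h x y) (xs x))"
    by (intro computable_intros assms)
qed (simp add: list_all_iff list_ex_iff)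

lemma computable_length [computable_intros]:
  assumes "computable xs"
  shows "computable (\<lambda>x. length (xs x))"
proof (rule computable_cong)
  show "computable (\<lambda>x. foldr (\<lambda>_. Suc) (xs x) 0)"
    by (intro computable_intros assms)
  have "foldr (\<lambda>_. Suc) xs 0 = length xs" for xs :: "'b list"
    by (induction xs) auto
  then show "foldr (\<lambda>_. Suc) (xs x) 0 = length (xs x)" for x .
qed

lemma computable_tl [computable_intros]: "computable xs \<Longrightarrow> computable (\<lambda>x. tl (xs x))"
  unfolding tl_def by (intro computable_intros)

lemma computable_replicate [computable_intros]:
  assumes "computable k" "computable y"
  shows "computable (\<lambda>x. replicate (k x) (y x))"
proof -
  have replicate: "((#) y ^^ k) [] = replicate k y" for k and y :: 'b
    by (induction k) auto
  have "computable (\<lambda>z. y (fst z))"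
    by (rule computable_compose[OF assms(2)]) (intro computable_intros)
  then have "computable (\<lambda>x. ((#) (y x) ^^ k x) [])"
    by (intro computable_intros assms(1))
  then show ?thesis
    by (simp only: replicate)
qed

lemma computable_zip [computable_intros]:
  fixes xs :: "'a::encodable \<Rightarrow> 'b::encodable list" and ys :: "'a \<Rightarrow> 'c::encodable list"
  assumes "computable xs" "computable ys"
  shows "computable (\<lambda>x. zip (xs x) (ys x))"
proof (rule computable_cong)
  define h :: "('b \<times> 'c) list \<times> 'c list \<Rightarrow> 'b \<Rightarrow> ('b \<times> 'c) list \<times> 'c list"
    where "h = (\<lambda>s x. case snd s of [] \<Rightarrow> s | z # zs \<Rightarrow> (fst s @ [(x, z)], zs))"
  show "computable (\<lambda>x. fst (foldl h ([], ys x) (xs x)))"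
    unfolding h_def by (intro computable_intros assms)
  have nil: "foldl h (a, []) xs = (a, [])" for a xs
    by (induction xs) (auto simp: h_def)
  have "fst (foldl h (a, ys) xs) = a @ zip xs ys" for a xs ys
  proof (induction xs arbitrary: a ys)
    case (Cons x xs)
    then show ?case
      by (cases ys) (simp_all add: nil, simp_all add: h_def)
  qed simp
  then show "fst (foldl h ([], ys x) (xs x)) = zip (xs x) (ys x)" for x
    by simp
qed

text \<open>The descending interval grows at its front, and its length is the next entry, so no
  separate counter is needed.\<close>

lemma computable_rev_upt [computable_intros]:
  assumes "computable k"
  shows "computable (\<lambda>x. rev [0..<k x])"
proof (rule computable_cong)
  show "computable (\<lambda>x. ((\<lambda>l. length l # l) ^^ k x) [])"
    by (intro computable_intros assms)
  have "((\<lambda>l. length l # l) ^^ k) [] = rev [0..<k]" for k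
    by (induction k) auto
  then show "((\<lambda>l. length l # l) ^^ k x) [] = rev [0..<k x]" for x .
qed

text \<open>Iterating the truncated predecessor gives truncated subtraction, and comparisons reduce
  to the vanishing of differences.\<close>

lemma computable_nat [computable_intros]:
  fixes j k :: "'a::encodable \<Rightarrow> nat"
  assumes "computable j" "computable k"
  shows "computable (\<lambda>x. j x - k x)" "computable (\<lambda>x. j x \<le> k x)" "computable (\<lambda>x. j x = k x)"
proof -
  have minus: "((\<lambda>l. l - 1) ^^ n) m = m - n" for m n :: nat
    by (induction n) auto
  have 1: "computable (\<lambda>x. j x - k x)" if "computable j" "computable k" for j k :: "'a \<Rightarrow> nat"
  proof -
    have "computable (\<lambda>x. ((\<lambda>l. l - 1) ^^ k x) (j x))"
      using that by (intro computable_intros)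
    then show ?thesis
      by (simp only: minus)
  qed
  show "computable (\<lambda>x. j x - k x)"
    using assms by (rule 1)
  have "computable (\<lambda>x. j x - k x = 0)"
    by (intro computable_intros 1 assms)
  moreover have "computable (\<lambda>x. j x - k x = 0 \<and> k x - j x = 0)"
    by (intro computable_intros 1 assms)
  moreover have "m - n = 0 \<and> n - m = 0 \<longleftrightarrow> m = n" for m n :: nat
    by auto
  ultimately show "computable (\<lambda>x. j x \<le> k x)" "computable (\<lambda>x. j x = k x)"
    by (simp_all only: diff_is_0_eq)
qed

lemma computable_eq_nat_list [computable_intros]:
  fixes xs ys :: "'a::encodable \<Rightarrow> nat list"
  assumes "computable xs" "computable ys"
  shows "computable (\<lambda>x. xs x = ys x)"
proof -
  have "length xs = length ys \<and> list_all (\<lambda>(a, b). a = b) (zip xs ys) \<longleftrightarrow> xs = ys"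
    for xs ys :: "nat list"
    by (auto simp: list_all_length list_eq_iff_nth_eq)
  moreover have "computable (\<lambda>x. length (xs x) = length (ys x) \<and>
      list_all (\<lambda>(a, b). a = b) (zip (xs x) (ys x)))"
    using assms by (intro computable_intros)
  ultimately show ?thesis
    by (simp only:)
qed

section \<open>Polynomials as lists of terms\<close>

text \<open>Exponent vectors and points of different lengths are compared after padding: missing
  exponents are 0 and missing coordinates are 1.\<close>

fun mon :: "nat list \<Rightarrow> complex list \<Rightarrow> complex" where
  "mon [] xs = 1"
| "mon (k # e) [] = mon e []"
| "mon (k # e) (x # xs) = x ^ k * mon e xs"

definition ev :: "complex terms \<Rightarrow> complex list \<Rightarrow> complex" where
  "ev p xs = (\<Sum>(e, c)\<leftarrow>p. c * mon e xs)"

definition head_exp :: "nat list \<Rightarrow> nat" where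
  "head_exp e = (case e of [] \<Rightarrow> 0 | k # _ \<Rightarrow> k)"

fun eadd :: "nat list \<Rightarrow> nat list \<Rightarrow> nat list" where
  "eadd [] f = f"
| "eadd e [] = e"
| "eadd (k # e) (l # f) = (k + l) # eadd e f"

definition tneg :: "complex terms \<Rightarrow> complex terms" where
  "tneg p = map (\<lambda>(e, c). (e, 0 - c)) p"

definition tmul :: "complex terms \<Rightarrow> complex terms \<Rightarrow> complex terms" where
  "tmul p q = concat (map (\<lambda>(e, c). map (\<lambda>(f, d). (eadd e f, c * d)) q) p)"

definition tone :: "complex terms" where
  "tone = [([], 1)]"

definition lift :: "complex terms \<Rightarrow> complex terms" where
  "lift p = map (\<lambda>(e, c). (0 # e, c)) p"

lemma mon_Nil [simp]: "mon e [] = 1"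
  by (induction e) auto

lemma mon_Cons: "mon e (x # xs) = x ^ head_exp e * mon (tl e) xs"
  by (cases e) (auto simp: head_exp_def)

lemma mon_eadd: "mon (eadd e f) xs = mon e xs * mon f xs"
proof (induction e f arbitrary: xs rule: eadd.induct)
  case (3 k e l f)
  then show ?case by (cases xs) (auto simp: power_add)
qed auto

lemma ev_Nil [simp]: "ev [] xs = 0"
  and ev_Cons [simp]: "ev ((e, c) # p) xs = c * mon e xs + ev p xs"
  and ev_append [simp]: "ev (p @ q) xs = ev p xs + ev q xs"
  by (simp_all add: ev_def)

lemma ev_tneg [simp]: "ev (tneg p) xs = - ev p xs"
  by (induction p) (auto simp: tneg_def)

lemma ev_tmul [simp]: "ev (tmul p q) xs = ev p xs * ev q xs"
proof (induction p)
  case Nil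
  then show ?case by (simp add: tmul_def)
next
  case (Cons t p)
  obtain e c where t: "t = (e, c)" by force
  have "ev (map (\<lambda>(f, d). (eadd e f, c * d)) q) xs = c * mon e xs * ev q xs"
    by (induction q) (auto simp: mon_eadd algebra_simps)
  then show ?case
    using Cons by (simp add: tmul_def t algebra_simps)
qed

lemma ev_tone [simp]: "ev tone xs = 1"
  by (simp add: tone_def)

lemma ev_lift [simp]: "ev (lift p) (x # xs) = ev p xs"
  by (induction p) (auto simp: lift_def)

lemma ev_funpow_tmul [simp]: "ev ((tmul g ^^ k) tone) xs = ev g xs ^ k"
  by (induction k) auto

section \<open>Polynomials in the first variable\<close>

text \<open>Lists of coefficients start with the leading one.\<close>

fun upoly :: "complex list \<Rightarrow> complex terms list \<Rightarrow> complex poly" where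
  "upoly xs [] = 0"
| "upoly xs (c # p) = monom (ev c xs) (length p) + upoly xs p"

definition coef :: "nat \<Rightarrow> complex terms \<Rightarrow> complex terms" where
  "coef i p = map (\<lambda>(e, c). (tl e, c)) (filter (\<lambda>(e, c). head_exp e = i) p)"

text \<open>The sum of all first exponents is a simple upper bound for the degree; it may produce
  leading zeros, which are allowed.\<close>

definition dense :: "complex terms \<Rightarrow> complex terms list" where
  "dense p = map (\<lambda>i. coef i p) (rev [0..<Suc (foldr (\<lambda>t s. head_exp (fst t) + s) p 0)])"

text \<open>Horner's scheme in the first variable.\<close>

definition sparse :: "complex terms list \<Rightarrow> complex terms" where
  "sparse p = foldl (\<lambda>s c. tmul [([1], 1)] s @ lift c) [] p"

lemma coeff_upoly_ge: "i \<ge> length p \<Longrightarrow> coeff (upoly xs p) i = 0"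
  by (induction p) auto

lemma coeff_upoly_lead: "coeff (upoly xs (c # p)) (length p) = ev c xs"
  by (simp add: coeff_upoly_ge)

text \<open>Over an infinite field a polynomial vanishing everywhere is zero, and then its
  coefficients vanish one by one from the leading one on.\<close>

lemma poly_upoly_coeffs: "(\<forall>x. poly (upoly xs p) x = 0) \<longleftrightarrow> (\<forall>c\<in>set p. ev c xs = 0)"
proof -
  have "upoly xs p = 0 \<longleftrightarrow> (\<forall>c\<in>set p. ev c xs = 0)"
  proof (induction p)
    case (Cons c p)
    show ?case
    proof
      assume 0: "upoly xs (c # p) = 0"
      then have "coeff (upoly xs (c # p)) (length p) = 0"
        by simp
      then have "ev c xs = 0"
        by (simp only: coeff_upoly_lead coeff_0)
      then show "\<forall>d\<in>set (c # p). ev d xs = 0"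
        using 0 Cons by simp
    qed (use Cons in simp)
  qed simp
  then show ?thesis
    by (simp add: poly_all_0_iff_0)
qed

lemma upoly_map_rev_upt:
  "upoly xs (map h (rev [0..<n])) = (\<Sum>i<n. monom (ev (h i) xs) i)"
  by (induction n) (auto simp: add.commute)

lemma poly_upoly_dense [simp]: "poly (upoly xs (dense p)) x = ev p (x # xs)"
proof -
  \<comment> \<open>The bound is generalized to any large \<open>n\<close>, since the sum of first
    exponents grows along the induction.\<close>
  have "(\<Sum>i<n. ev (coef i p) xs * x ^ i) = ev p (x # xs)"
    if "foldr (\<lambda>t s. head_exp (fst t) + s) p 0 < n" for n
    using that
  proof (induction p)
    case (Cons t p)
    obtain e c where t: "t = (e, c)" by force
    have "ev (coef i (t # p)) xs * x ^ i =
        (if i = head_exp e then c * mon (tl e) xs * x ^ i else 0) + ev (coef i p) xs * x ^ i" for i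
      by (simp add: t coef_def algebra_simps)
    then have "(\<Sum>i<n. ev (coef i (t # p)) xs * x ^ i) =
        (\<Sum>i<n. if i = head_exp e then c * mon (tl e) xs * x ^ i else 0) + ev p (x # xs)"
      using Cons by (simp add: t sum.distrib)
    then show ?case
      using Cons.prems by (simp add: t mon_Cons sum.delta)
  qed (simp add: coef_def)
  from this[OF lessI] show ?thesis
    unfolding dense_def upoly_map_rev_upt by (simp add: poly_sum poly_monom)
qed

lemma ev_sparse [simp]: "ev (sparse p) (x # xs) = poly (upoly xs p) x"
proof -
  have "ev (foldl (\<lambda>s c. tmul [([1], 1)] s @ lift c) s p) (x # xs) =
      ev s (x # xs) * x ^ length p + poly (upoly xs p) x" for s
    by (induction p arbitrary: s) (auto simp: poly_monom algebra_simps)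
  then show ?thesis
    by (simp add: sparse_def)
qed

subsection \<open>Pseudo-division\<close>

definition head_coef :: "complex terms list \<Rightarrow> complex terms" where
  "head_coef p = (case p of [] \<Rightarrow> [] | c # _ \<Rightarrow> c)"

text \<open>This is \<open>q\<close> times the head of \<open>p\<close>, minus \<open>p\<close>
  times the head of \<open>q\<close> and a power of the variable; appending empty coefficients
  multiplies by that power. The leading terms cancel identically, so both heads are removed by
  \<open>tl\<close>.\<close>

definition pseudo_step :: "complex terms list \<Rightarrow> complex terms list \<Rightarrow> complex terms list" where
  "pseudo_step p q = map (\<lambda>(a, b). tmul (head_coef p) b @ tneg (tmul (head_coef q) a))
     (zip (tl p @ replicate (length q - length p) []) (tl q))"

text \<open>For non-empty \<open>p\<close> each effective step shortens the list by one, so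
  \<open>length q\<close> rounds suffice; surplus rounds change nothing.\<close>

definition pseudo_rem :: "complex terms list \<Rightarrow> complex terms list \<Rightarrow> complex terms list" where
  "pseudo_rem p q =
     ((\<lambda>r. if length p \<le> length r then pseudo_step p r else r) ^^ length q) q"

lemma upoly_append_replicate: "upoly xs (p @ replicate k []) = monom 1 k * upoly xs p"
proof (induction p)
  case Nil
  then show ?case by (induction k) auto
next
  case (Cons c p)
  then show ?case by (simp add: algebra_simps mult_monom)
qed

lemma upoly_map_zip:
  assumes "length p = length q"
  shows "upoly xs (map (\<lambda>(a, b). tmul c b @ tneg (tmul d a)) (zip p q)) =
    smult (ev c xs) (upoly xs q) - smult (ev d xs) (upoly xs p)"
  using assms
  by (induction p q rule: list_induct2)
    (auto simp: smult_add_right smult_monom smult_diff_right diff_monom[symmetric] add_monom)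

lemma length_pseudo_step:
  "length p \<le> length q \<Longrightarrow> p \<noteq> [] \<Longrightarrow> length (pseudo_step p q) = length q - 1"
  by (cases p; cases q) (auto simp: pseudo_step_def)

lemma upoly_pseudo_step:
  assumes "length (c # p) \<le> length q"
  shows "smult (ev c xs) (upoly xs q) =
    monom (ev (head_coef q) xs) (length q - length (c # p)) * upoly xs (c # p) +
    upoly xs (pseudo_step (c # p) q)"
proof (cases q)
  case (Cons b q')
  define k where "k = length q' - length p"
  have len: "length q' = length p + k"
    using assms Cons by (simp add: k_def)
  have "upoly xs (pseudo_step (c # p) q) =
      smult (ev c xs) (upoly xs q') - smult (ev b xs) (monom 1 k * upoly xs p)"
    unfolding pseudo_step_def
    by (subst upoly_map_zip) (simp_all add: Cons head_coef_def len upoly_append_replicate)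
  moreover have "smult (ev b xs) (monom 1 k * upoly xs p) = monom (ev b xs) k * upoly xs p"
    by (metis mult_smult_left smult_monom mult.right_neutral)
  ultimately show ?thesis
    by (simp add: Cons head_coef_def len smult_add_right smult_monom algebra_simps mult_monom)
qed (use assms in simp)

text \<open>By the pseudo-division identity the result differs from a scalar multiple of
  \<open>q\<close> by a multiple of the divisor, and the scalar \<open>ev c xs\<close> is a
  unit.\<close>

lemma dvd_pseudo_step:
  assumes "length (c # p) \<le> length q" "ev c xs \<noteq> 0"
  shows "upoly xs (c # p) dvd upoly xs (pseudo_step (c # p) q) \<longleftrightarrow> upoly xs (c # p) dvd upoly xs q"
proof -
  have "upoly xs (c # p) dvd upoly xs (pseudo_step (c # p) q) \<longleftrightarrow>
      upoly xs (c # p) dvd smult (ev c xs) (upoly xs q)"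
    unfolding upoly_pseudo_step[OF assms(1)] by (simp only: dvd_add_right_iff dvd_triv_right)
  then show ?thesis
    using assms(2) by (simp add: dvd_smult_iff)
qed

lemma poly_pseudo_step:
  assumes "length (c # p) \<le> length q" "ev c xs \<noteq> 0" "poly (upoly xs (c # p)) x = 0"
  shows "poly (upoly xs (pseudo_step (c # p) q)) x = 0 \<longleftrightarrow> poly (upoly xs q) x = 0"
proof -
  have "ev c xs * poly (upoly xs q) x = poly (smult (ev c xs) (upoly xs q)) x"
    by simp
  also have "\<dots> = poly (upoly xs (pseudo_step (c # p) q)) x"
    unfolding upoly_pseudo_step[OF assms(1)] using assms(3) by simp
  finally show ?thesis
    using assms(2) by (metis mult_eq_0_iff)
qed

text \<open>In the length bound \<open>p\<close> is the tail of the divisor, so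
  \<open>length p\<close> is the degree of the divisor and lists of at most that length are no
  longer reduced.\<close>

lemma pseudo_rem_iter:
  fixes p :: "complex terms list"
  assumes "ev c xs \<noteq> 0"
  defines "s \<equiv> \<lambda>r. if length (c # p) \<le> length r then pseudo_step (c # p) r else r"
  shows "length ((s ^^ n) q) \<le> max (length p) (length q - n) \<and>
    (upoly xs (c # p) dvd upoly xs ((s ^^ n) q) \<longleftrightarrow> upoly xs (c # p) dvd upoly xs q)"
proof (induction n)
  case (Suc n)
  define r where "r = (s ^^ n) q"
  have "length (s r) \<le> max (length p) (length r - 1)"
    by (auto simp: s_def length_pseudo_step)
  moreover have "upoly xs (c # p) dvd upoly xs (s r) \<longleftrightarrow> upoly xs (c # p) dvd upoly xs r"
    unfolding s_def using dvd_pseudo_step[OF _ assms(1)] by simp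
  ultimately show ?case
    using Suc by (auto simp: r_def)
qed simp

lemma pseudo_rem_eq_0_iff:
  assumes "ev c xs \<noteq> 0"
  shows "upoly xs (pseudo_rem (c # p) q) = 0 \<longleftrightarrow> upoly xs (c # p) dvd upoly xs q"
proof -
  define r where "r = pseudo_rem (c # p) q"
  have len: "length r \<le> length p" and dvd: "upoly xs (c # p) dvd upoly xs r \<longleftrightarrow> upoly xs (c # p) dvd upoly xs q"
    using pseudo_rem_iter[OF assms, where p = p and n = "length q" and q = q]
    by (auto simp: r_def pseudo_rem_def)
  \<comment> \<open>The remainder has fewer coefficients than the divisor, whose leading one is
    non-zero; for degree reasons it is a multiple only if it is zero.\<close>
  have "upoly xs r = 0" if "upoly xs (c # p) dvd upoly xs r"
  proof (rule ccontr)
    assume 0: "upoly xs r \<noteq> 0"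
    have "length p \<le> degree (upoly xs (c # p))"
      using coeff_upoly_lead[of xs c p] assms by (intro le_degree) simp
    also have "\<dots> \<le> degree (upoly xs r)"
      using that 0 by (rule dvd_imp_degree_le)
    finally have "coeff (upoly xs r) (degree (upoly xs r)) = 0"
      using len by (intro coeff_upoly_ge) simp
    then show False
      using 0 by simp
  qed
  then show ?thesis
    using dvd by (auto simp: r_def)
qed

lemma degree_upoly_lead: "ev c xs \<noteq> 0 \<Longrightarrow> degree (upoly xs (c # p)) = length p"
  using coeff_upoly_lead[of xs c p] coeff_upoly_ge[of "c # p" _ xs]
  by (intro antisym le_degree degree_le) auto

lemma common_root_iff_pseudo_rem:
  assumes "ev c xs \<noteq> 0"
  shows "(\<exists>x. poly (upoly xs (c # p)) x = 0 \<and> ev g (x # xs) \<noteq> 0) \<longleftrightarrow>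
    (\<exists>x. poly (upoly xs (pseudo_rem (c # p) (dense ((tmul g ^^ length p) tone)))) x \<noteq> 0)"
proof -
  define G where "G = upoly xs (dense g)"
  have "poly (upoly xs (dense ((tmul g ^^ length p) tone))) = poly (G ^ length p)"
    by (auto simp: G_def)
  then have G: "upoly xs (dense ((tmul g ^^ length p) tone)) = G ^ length p"
    by (simp add: poly_eq_poly_eq_iff)
  have "upoly xs (c # p) \<noteq> 0"
    using coeff_upoly_lead[of xs c p] assms by (metis coeff_0)
  \<comment> \<open>The univariate Nullstellensatz: the exponent, the degree of the divisor, bounds
    all multiplicities of its roots. It equals \<open>length p\<close> because the leading
    coefficient does not vanish at \<open>xs\<close>.\<close>
  then have "(\<forall>x. poly (upoly xs (c # p)) x = 0 \<longrightarrow> poly G x = 0) \<longleftrightarrow>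
      upoly xs (c # p) dvd G ^ length p"
    using nullstellensatz_univariate[of "upoly xs (c # p)" G] degree_upoly_lead[OF assms] by simp
  also have "\<dots> \<longleftrightarrow> (\<forall>x. poly (upoly xs (pseudo_rem (c # p) (dense ((tmul g ^^ length p) tone)))) x = 0)"
    using pseudo_rem_eq_0_iff[OF assms, of p] by (simp add: G poly_all_0_iff_0)
  finally show ?thesis
    by (auto simp: G_def)
qed

section \<open>Elimination of a variable\<close>

text \<open>A state \<open>(Z, P, g)\<close> stands for the system \<open>Z = 0\<close>, \<open>P = 0\<close>, \<open>g \<noteq> 0\<close>, where the first variable
  does not occur in \<open>Z\<close>.\<close>

type_synonym state = "complex terms list \<times> complex terms list list \<times> complex terms"

definition sat_state :: "complex list \<Rightarrow> state \<Rightarrow> bool" where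
  "sat_state xs = (\<lambda>(Z, P, g). \<exists>x. (\<forall>z\<in>set Z. ev z xs = 0) \<and>
     (\<forall>p\<in>set P. poly (upoly xs p) x = 0) \<and> ev g (x # xs) \<noteq> 0)"

definition reduce_pair :: "complex terms list \<Rightarrow> complex terms list \<Rightarrow> complex terms list \<Rightarrow>
    complex terms list list \<Rightarrow> complex terms \<Rightarrow> state list" where
  "reduce_pair Z p q ps g = (case p of [] \<Rightarrow> [(Z, q # ps, g)]
     | c # p' \<Rightarrow> [(c # Z, p' # q # ps, g), (Z, p # pseudo_step p q # ps, tmul (lift c) g)])"

text \<open>The remainder is returned as an inequation still containing the variable:
  \<open>sat_state\<close> asks for some value of it, and a remainder with a non-zero value is a
  non-zero polynomial. The factor \<open>lift c\<close> records the assumption of the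
  branch.\<close>

definition reduce_single :: "complex terms list \<Rightarrow> complex terms list \<Rightarrow> complex terms \<Rightarrow> state list"
  where
  "reduce_single Z p g = (case p of [] \<Rightarrow> [(Z, [], g)]
     | c # p' \<Rightarrow> [(c # Z, [p'], g),
         (Z, [], tmul (lift c) (sparse (pseudo_rem p (dense ((tmul g ^^ length p') tone)))))])"

definition elim_step :: "state \<Rightarrow> state list" where
  "elim_step = (\<lambda>(Z, P, g). case P of [] \<Rightarrow> [(Z, [], g)]
     | p # P' \<Rightarrow> (case P' of [] \<Rightarrow> reduce_single Z p g
         | q # ps \<Rightarrow> if length p \<le> length q then reduce_pair Z p q ps g
             else reduce_pair Z q p ps g))"

text \<open>The \<open>Suc\<close> makes empty polynomials count, so that discarding one lowers the
  rank as well.\<close>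

definition rank :: "state \<Rightarrow> nat" where
  "rank = (\<lambda>(Z, P, g). foldr (\<lambda>p s. Suc (length p) + s) P 0)"

definition elim :: "state \<Rightarrow> state list" where
  "elim s = ((\<lambda>S. concat (map elim_step S)) ^^ rank s) [s]"

text \<open>Where \<open>c\<close> vanishes, the factor \<open>lift c\<close> makes the second
  branch unsatisfiable and the first one only drops a zero term. Elsewhere the first branch fails,
  and the division step preserves the common zeros.\<close>

lemma sat_reduce_pair:
  assumes "length p \<le> length q"
  shows "(\<exists>s\<in>set (reduce_pair Z p q ps g). sat_state xs s) \<longleftrightarrow> sat_state xs (Z, p # q # ps, g)"
proof (cases p)
  case (Cons c p')
  show ?thesis
  proof (cases "ev c xs = 0")
    case False
    have "poly (upoly xs (c # p')) x = 0 \<and> poly (upoly xs (pseudo_step (c # p') q)) x = 0 \<longleftrightarrow>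
        poly (upoly xs (c # p')) x = 0 \<and> poly (upoly xs q) x = 0" for x
      using poly_pseudo_step[OF assms[unfolded Cons] False] by blast
    then show ?thesis
      using False by (simp add: sat_state_def reduce_pair_def Cons del: upoly.simps) metis
  qed (auto simp: sat_state_def reduce_pair_def Cons)
qed (auto simp: sat_state_def reduce_pair_def)

text \<open>The same case split, with the criterion for common roots where \<open>c\<close> is
  non-zero. If \<open>p'\<close> is empty, then \<open>g\<close> to the power 0 leaves remainder 0
  modulo a non-zero constant, and the branch rightly fails.\<close>

lemma sat_reduce_single:
  "(\<exists>s\<in>set (reduce_single Z p g). sat_state xs s) \<longleftrightarrow> sat_state xs (Z, [p], g)"
proof (cases p)
  case (Cons c p')
  show ?thesis
  proof (cases "ev c xs = 0")
    case False
    then show ?thesis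
      using common_root_iff_pseudo_rem[OF False, of p' g]
      by (simp add: sat_state_def reduce_single_def Cons del: upoly.simps)
  qed (auto simp: sat_state_def reduce_single_def Cons)
qed (auto simp: sat_state_def reduce_single_def)

lemma sat_elim_step: "(\<exists>s'\<in>set (elim_step s). sat_state xs s') \<longleftrightarrow> sat_state xs s"
proof -
  obtain Z P g where s: "s = (Z, P, g)"
    by (cases s)
  have swap: "sat_state xs (Z, q # p # ps, g) = sat_state xs (Z, p # q # ps, g)" for p q ps
    by (auto simp: sat_state_def)
  consider "P = []" | p where "P = [p]" | p q ps where "P = p # q # ps"
    by (metis neq_Nil_conv)
  then show ?thesis
  proof cases
    case (3 p q ps)
    show ?thesis
    proof (cases "length p \<le> length q")
      case True
      then show ?thesis
        using sat_reduce_pair[OF True] by (simp add: s 3 elim_step_def)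
    next
      case False
      then show ?thesis
        using sat_reduce_pair[of q p Z ps g xs] by (simp add: s 3 elim_step_def swap)
    qed
  qed (simp_all add: s elim_step_def sat_reduce_single)
qed

text \<open>Truncated subtraction accounts for finished states, which have rank 0 and are returned
  unchanged.\<close>

lemma rank_elim_step:
  assumes "s' \<in> set (elim_step s)"
  shows "rank s' \<le> rank s - 1"
proof -
  obtain Z P g where s: "s = (Z, P, g)"
    by (cases s)
  have pair: "rank s' < rank (Z, p # q # ps, g)"
    if "s' \<in> set (reduce_pair Z p q ps g)" "length p \<le> length q" for p q ps
    using that by (cases p) (auto simp: rank_def reduce_pair_def length_pseudo_step)
  have single: "rank s' < rank (Z, [p], g)" if "s' \<in> set (reduce_single Z p g)" for p
    using that by (cases p) (auto simp: rank_def reduce_single_def)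
  have swap: "rank (Z, q # p # ps, g) = rank (Z, p # q # ps, g)" for p q ps
    by (simp add: rank_def)
  consider "P = []" | p where "P = [p]" | p q ps where "P = p # q # ps"
    by (metis neq_Nil_conv)
  then show ?thesis
  proof cases
    case 1
    then show ?thesis
      using assms by (simp add: s elim_step_def rank_def)
  next
    case (2 p)
    then show ?thesis
      using assms single[of p] by (simp add: s elim_step_def)
  next
    case (3 p q ps)
    then show ?thesis
      using assms pair[of p q ps] pair[of q p ps] swap[of q p ps]
      by (simp add: s elim_step_def split: if_splits)
  qed
qed

lemma sat_elim: "(\<exists>s'\<in>set (elim s). sat_state xs s') \<longleftrightarrow> sat_state xs s"
proof -
  have "(\<exists>s'\<in>set (((\<lambda>S. concat (map elim_step S)) ^^ k) [s]). sat_state xs s') \<longleftrightarrow> sat_state xs s"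
    for k
    using sat_elim_step by (induction k) auto
  then show ?thesis
    by (simp add: elim_def)
qed

lemma elim_eliminates:
  assumes "(Z, P, g) \<in> set (elim s)"
  shows "P = []"
proof -
  have "s' \<in> set (((\<lambda>S. concat (map elim_step S)) ^^ k) [s]) \<Longrightarrow> rank s' \<le> rank s - k" for k s'
  proof (induction k arbitrary: s')
    case (Suc k)
    then obtain s'' where "s'' \<in> set (((\<lambda>S. concat (map elim_step S)) ^^ k) [s])"
      "s' \<in> set (elim_step s'')"
      by auto
    then show ?case
      using Suc.IH[of s''] rank_elim_step[of s' s''] by simp
  qed simp
  from this[of _ "rank s"] have "rank (Z, P, g) = 0"
    using assms by (force simp: elim_def)
  then show ?thesis
    by (cases P) (auto simp: rank_def)
qed

section \<open>Projection of systems with one inequation\<close>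

type_synonym polsys = "complex terms list \<times> complex terms"

definition sat_sys :: "complex list \<Rightarrow> polsys \<Rightarrow> bool" where
  "sat_sys xs = (\<lambda>(E, g). (\<forall>e\<in>set E. ev e xs = 0) \<and> ev g xs \<noteq> 0)"

text \<open>After elimination the variable occurs only in \<open>h\<close>. Some value makes
  \<open>h\<close> non-zero iff some coefficient of \<open>h\<close> is non-zero, which gives one
  system per coefficient.\<close>

definition project :: "polsys \<Rightarrow> polsys list" where
  "project = (\<lambda>(E, g).
     concat (map (\<lambda>(Z, P, h). map (Pair Z) (dense h)) (elim ([], map dense E, g))))"

text \<open>The value at the empty point, used once all variables are eliminated.\<close>

definition total :: "complex terms \<Rightarrow> complex" where
  "total p = foldr (\<lambda>t s. snd t + s) p 0"

definition solvable :: "nat \<Rightarrow> complex terms list \<Rightarrow> bool" where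
  "solvable d E = list_ex (\<lambda>(E, g). list_all (\<lambda>e. total e = 0) E \<and> total g \<noteq> 0)
     (((\<lambda>S. concat (map project S)) ^^ d) [(E, tone)])"

lemma sat_project: "(\<exists>s\<in>set (project S). sat_sys xs s) \<longleftrightarrow> (\<exists>x. sat_sys (x # xs) S)"
proof -
  obtain E g where S: "S = (E, g)"
    by force
  have final: "(\<exists>r\<in>set (dense h). sat_sys xs (Z, r)) \<longleftrightarrow> sat_state xs (Z, [], h)" for Z h
    using poly_upoly_coeffs[of xs "dense h"] by (auto simp: sat_sys_def sat_state_def)
  have "(\<exists>s\<in>set (project S). sat_sys xs s) \<longleftrightarrow>
      (\<exists>(Z, P, h)\<in>set (elim ([], map dense E, g)). \<exists>r\<in>set (dense h). sat_sys xs (Z, r))"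
    by (simp add: project_def S split_def)
  also have "\<dots> \<longleftrightarrow> (\<exists>s\<in>set (elim ([], map dense E, g)). sat_state xs s)"
    unfolding final using elim_eliminates by (fastforce simp: Bex_def)
  also have "\<dots> \<longleftrightarrow> (\<exists>x. sat_sys (x # xs) S)"
    unfolding sat_elim by (auto simp: sat_state_def sat_sys_def S)
  finally show ?thesis .
qed

lemma total_eq_ev: "total p = ev p []"
  by (induction p) (auto simp: total_def)

lemma solvable_iff: "solvable d E \<longleftrightarrow> (\<exists>ts. length ts = d \<and> (\<forall>e\<in>set E. ev e ts = 0))"
proof -
  have "(\<exists>s\<in>set (((\<lambda>S. concat (map project S)) ^^ d) [S]). sat_sys xs s) \<longleftrightarrow>
      (\<exists>ts. length ts = d \<and> sat_sys (ts @ xs) S)" for xs S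
  proof (induction d arbitrary: xs)
    case (Suc d)
    have "(\<exists>s\<in>set (((\<lambda>S. concat (map project S)) ^^ Suc d) [S]). sat_sys xs s) \<longleftrightarrow>
        (\<exists>x. \<exists>s\<in>set (((\<lambda>S. concat (map project S)) ^^ d) [S]). sat_sys (x # xs) s)"
      using sat_project by auto
    \<comment> \<open>The outermost \<open>project\<close> removes the last of the
      \<open>Suc d\<close> variables, so its value stands behind \<open>ts\<close>.\<close>
    also have "\<dots> \<longleftrightarrow> (\<exists>x ts. length ts = d \<and> sat_sys ((ts @ [x]) @ xs) S)"
      unfolding Suc.IH by simp
    also have "\<dots> \<longleftrightarrow> (\<exists>ts. length ts = Suc d \<and> sat_sys (ts @ xs) S)"
      by (metis length_append_singleton length_Suc_conv_rev)
    finally show ?case .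
  qed simp
  from this[of "(E, tone)" "[]"] show ?thesis
    by (simp add: solvable_def list_ex_iff list_all_iff total_eq_ev sat_sys_def split_def)
qed

section \<open>The membership test\<close>

text \<open>A polynomial in the parameters, vanishing at \<open>t\<close> iff \<open>a\<close> and the specialization of \<open>b\<close> at \<open>t\<close>
  have the same coefficient at the monomial with exponents \<open>e\<close>.\<close>

definition coef_eqn :: "nat list \<Rightarrow> complex terms \<Rightarrow> complex terms terms \<Rightarrow> complex terms" where
  "coef_eqn e a b = map (\<lambda>(f, c). ([], c)) (filter (\<lambda>(f, c). f = e) a) @
     tneg (concat (map snd (filter (\<lambda>(f, q). f = e) b)))"

text \<open>Monomials occurring in neither polynomial have coefficient 0 on both sides, so finitely
  many equations suffice.\<close>

definition eqns :: "complex terms list \<Rightarrow> complex terms terms list \<Rightarrow> complex terms list" where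
  "eqns F Q = concat (map (\<lambda>(a, b). map (\<lambda>e. coef_eqn e a b) (map fst a @ map fst b)) (zip F Q))"

section \<open>Polynomial functions determine their coefficients\<close>

definition coefficient :: "nat list \<Rightarrow> complex terms \<Rightarrow> complex" where
  "coefficient e p = (\<Sum>(f, c)\<leftarrow>p. if f = e then c else 0)"

lemma coefficient_Nil [simp]: "coefficient e [] = 0"
  and coefficient_Cons [simp]:
    "coefficient e ((f, c) # p) = (if f = e then c else 0) + coefficient e p"
  and coefficient_append [simp]: "coefficient e (p @ q) = coefficient e p + coefficient e q"
  by (simp_all add: coefficient_def)

lemma coefficient_tneg [simp]: "coefficient e (tneg p) = - coefficient e p"
  by (induction p) (auto simp: tneg_def)

lemma ev_coef_eqn:
  "ev (coef_eqn e a b) ts = coefficient e a - coefficient e (map (\<lambda>(f, q). (f, ev q ts)) b)"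
proof -
  have "ev (map (\<lambda>(f, c). ([], c)) (filter (\<lambda>(f, c). f = e) a)) ts = coefficient e a"
    by (induction a) auto
  moreover have "ev (concat (map snd (filter (\<lambda>(f, q). f = e) b))) ts =
      coefficient e (map (\<lambda>(f, q). (f, ev q ts)) b)"
    by (induction b) auto
  ultimately show ?thesis
    by (simp add: coef_eqn_def)
qed

lemma ev_eq_sum_coefficients:
  "finite M \<Longrightarrow> fst ` set p \<subseteq> M \<Longrightarrow> ev p xs = (\<Sum>e\<in>M. coefficient e p * mon e xs)"
proof (induction p)
  case (Cons t p)
  obtain f c where t: "t = (f, c)" by force
  have "(\<Sum>e\<in>M. coefficient e (t # p) * mon e xs) =
      (\<Sum>e\<in>M. if f = e then c * mon e xs else 0) + (\<Sum>e\<in>M. coefficient e p * mon e xs)"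
    unfolding sum.distrib[symmetric] by (rule sum.cong) (auto simp: t algebra_simps)
  then show ?case
    using Cons by (simp add: t)
qed simp

text \<open>Empty exponent vectors are excluded because \<open>coef\<close> treats \<open>[]\<close>
  like \<open>[0]\<close>.\<close>

lemma coefficient_coef:
  assumes "\<forall>(e, c)\<in>set p. e \<noteq> []"
  shows "coefficient e (coef i p) = coefficient (i # e) p"
  using assms
proof (induction p)
  case (Cons t p)
  obtain f c where t: "t = (f, c)" by force
  then obtain k f' where "f = k # f'"
    using Cons.prems by (cases f) auto
  then show ?case
    using Cons by (auto simp: t coef_def head_exp_def)
qed (simp add: coef_def)

lemma coef_eq_Nil_or_in_dense: "coef i p = [] \<or> coef i p \<in> set (dense p)"
proof (cases "i < Suc (foldr (\<lambda>t s. head_exp (fst t) + s) p 0)")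
  case False
  have "head_exp e \<le> foldr (\<lambda>t s. head_exp (fst t) + s) p 0" if "(e, c) \<in> set p" for e c
    using that by (induction p) (auto intro: trans_le_add2)
  then show ?thesis
    using False by (fastforce simp: coef_def filter_empty_conv)
qed (auto simp: dense_def simp del: upt_Suc)

text \<open>With the other coordinates fixed, the polynomial in the first variable vanishes
  everywhere, hence so do its coefficients; these are polynomials in one variable less.\<close>

lemma ev_eq_0_imp_coefficient_eq_0:
  assumes "\<forall>(e, c)\<in>set p. length e = n" "\<And>xs. length xs = n \<Longrightarrow> ev p xs = 0" "length e = n"
  shows "coefficient e p = 0"
  using assms
proof (induction n arbitrary: p e)
  case 0
  have "coefficient [] p = ev p []"
    using "0.prems"(1) by (induction p) auto
  then show ?case
    using 0 by simp
next
  case (Suc n)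
  obtain i e' where e: "e = i # e'" "length e' = n"
    using Suc.prems(3) by (cases e) auto
  have "coefficient e' (coef i p) = 0"
  proof (rule Suc.IH)
    show "\<forall>(e, c)\<in>set (coef i p). length e = n"
      using Suc.prems(1) by (auto simp: coef_def)
    show "ev (coef i p) xs = 0" if "length xs = n" for xs
    proof -
      have "\<forall>x. poly (upoly xs (dense p)) x = 0"
        using Suc.prems(2) that by simp
      then show ?thesis
        using coef_eq_Nil_or_in_dense[of i p] by (auto simp: poly_upoly_coeffs simp del: poly_upoly_dense)
    qed
  qed fact
  moreover have "\<forall>(e, c)\<in>set p. e \<noteq> []"
    using Suc.prems(1) by auto
  ultimately show ?case
    by (simp add: e coefficient_coef)
qed

lemma ev_eq_iff_coefficients_eq:
  assumes "\<forall>(e, c)\<in>set p. length e = n" "\<forall>(e, c)\<in>set q. length e = n"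
  shows "(\<forall>xs. length xs = n \<longrightarrow> ev p xs = ev q xs) \<longleftrightarrow>
    (\<forall>e\<in>fst ` set p \<union> fst ` set q. coefficient e p = coefficient e q)"
proof
  assume eq: "\<forall>xs. length xs = n \<longrightarrow> ev p xs = ev q xs"
  have "coefficient e (p @ tneg q) = 0" if "length e = n" for e
  proof (rule ev_eq_0_imp_coefficient_eq_0[OF _ _ that])
    show "\<forall>(e, c)\<in>set (p @ tneg q). length e = n"
      using assms by (auto simp: tneg_def)
  qed (use eq in simp)
  then show "\<forall>e\<in>fst ` set p \<union> fst ` set q. coefficient e p = coefficient e q"
    using assms by fastforce
next
  assume eq: "\<forall>e\<in>fst ` set p \<union> fst ` set q. coefficient e p = coefficient e q"
  show "\<forall>xs. length xs = n \<longrightarrow> ev p xs = ev q xs"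
    using eq ev_eq_sum_coefficients[of "fst ` set p \<union> fst ` set q"] by simp
qed

section \<open>Computability of the elimination procedure\<close>

lemma computable_head_exp [computable_intros]:
  "computable e \<Longrightarrow> computable (\<lambda>x. head_exp (e x))"
  unfolding head_exp_def by (intro computable_intros)

lemma computable_eadd [computable_intros]:
  assumes "computable e" "computable f"
  shows "computable (\<lambda>x. eadd (e x) (f x))"
proof (rule computable_cong)
  \<comment> \<open>The fold over \<open>e\<close> keeps the sums so far and the unread part of
    \<open>f\<close>, which is appended at the end in accordance with padding by zeros.\<close>
  define h :: "nat list \<times> nat list \<Rightarrow> nat \<Rightarrow> nat list \<times> nat list"
    where "h = (\<lambda>s k. case snd s of [] \<Rightarrow> (fst s @ [k], []) | l # f \<Rightarrow> (fst s @ [k + l], f))"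
  show "computable (\<lambda>x. fst (foldl h ([], f x) (e x)) @ snd (foldl h ([], f x) (e x)))"
    unfolding h_def by (intro computable_intros assms)
  have "fst (foldl h (a, f) e) @ snd (foldl h (a, f) e) = a @ eadd e f" for a e f
  proof (induction e arbitrary: a f)
    case (Cons k e)
    have "h (a, []) k = (a @ [k], [])" "h (a, l # f) k = (a @ [k + l], f)" for l f
      by (simp_all add: h_def)
    moreover have "eadd e [] = e"
      by (cases e) simp_all
    ultimately show ?case
      by (cases f) (simp_all add: Cons.IH)
  qed simp
  then show "fst (foldl h ([], f x) (e x)) @ snd (foldl h ([], f x) (e x)) = eadd (e x) (f x)" for x
    by simp
qed

lemma computable_tneg [computable_intros]: "computable p \<Longrightarrow> computable (\<lambda>x. tneg (p x))"
  unfolding tneg_def by (intro computable_intros)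

lemma computable_tmul [computable_intros]:
  "computable p \<Longrightarrow> computable q \<Longrightarrow> computable (\<lambda>x. tmul (p x) (q x))"
  by (rule computable_compose2[of tmul], unfold tmul_def) (intro computable_intros)

lemma computable_tone [computable_intros]: "computable (\<lambda>x. tone)"
  unfolding tone_def by (intro computable_intros)

lemma computable_lift [computable_intros]: "computable p \<Longrightarrow> computable (\<lambda>x. lift (p x))"
  unfolding lift_def by (intro computable_intros)

lemma computable_coef [computable_intros]:
  "computable i \<Longrightarrow> computable p \<Longrightarrow> computable (\<lambda>x. coef (i x) (p x))"
  by (rule computable_compose2[of coef], unfold coef_def) (intro computable_intros)

lemma computable_dense [computable_intros]: "computable p \<Longrightarrow> computable (\<lambda>x. dense (p x))"
  by (rule computable_compose[of dense], unfold dense_def)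
    \<comment> \<open>The descending interval has to be treated as a whole, since ascending
      intervals have no rule of their own.\<close>
    (intro computable_rev_upt computable_intros)

lemma computable_sparse [computable_intros]: "computable p \<Longrightarrow> computable (\<lambda>x. sparse (p x))"
  unfolding sparse_def by (intro computable_intros)

lemma computable_head_coef [computable_intros]:
  "computable p \<Longrightarrow> computable (\<lambda>x. head_coef (p x))"
  unfolding head_coef_def by (intro computable_intros)

lemma computable_pseudo_step [computable_intros]:
  "computable p \<Longrightarrow> computable q \<Longrightarrow> computable (\<lambda>x. pseudo_step (p x) (q x))"
  by (rule computable_compose2[of pseudo_step], unfold pseudo_step_def) (intro computable_intros)

lemma computable_pseudo_rem [computable_intros]:
  "computable p \<Longrightarrow> computable q \<Longrightarrow> computable (\<lambda>x. pseudo_rem (p x) (q x))"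
  by (rule computable_compose2[of pseudo_rem], unfold pseudo_rem_def) (intro computable_intros)

lemma computable_elim_step [computable_intros]:
  "computable s \<Longrightarrow> computable (\<lambda>x. elim_step (s x))"
  by (rule computable_compose[of elim_step],
      unfold elim_step_def reduce_single_def reduce_pair_def) (intro computable_intros)

lemma computable_rank [computable_intros]: "computable s \<Longrightarrow> computable (\<lambda>x. rank (s x))"
  by (rule computable_compose[of rank], unfold rank_def) (intro computable_intros)

lemma computable_elim [computable_intros]: "computable s \<Longrightarrow> computable (\<lambda>x. elim (s x))"
  by (rule computable_compose[of elim], unfold elim_def) (intro computable_intros)

lemma computable_project [computable_intros]:
  "computable s \<Longrightarrow> computable (\<lambda>x. project (s x))"
  by (rule computable_compose[of project], unfold project_def) (intro computable_intros)

lemma computable_total [computable_intros]: "computable p \<Longrightarrow> computable (\<lambda>x. total (p x))"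
  unfolding total_def by (intro computable_intros)

lemma computable_solvable [computable_intros]:
  "computable d \<Longrightarrow> computable E \<Longrightarrow> computable (\<lambda>x. solvable (d x) (E x))"
  by (rule computable_compose2[of solvable], unfold solvable_def) (intro computable_intros)

lemma computable_coef_eqn [computable_intros]:
  "computable e \<Longrightarrow> computable a \<Longrightarrow> computable b \<Longrightarrow> computable (\<lambda>x. coef_eqn (e x) (a x) (b x))"
  by (rule computable_compose3[of coef_eqn], unfold coef_eqn_def) (intro computable_intros)

lemma computable_eqns [computable_intros]:
  "computable F \<Longrightarrow> computable Q \<Longrightarrow> computable (\<lambda>x. eqns (F x) (Q x))"
  by (rule computable_compose2[of eqns], unfold eqns_def) (intro computable_intros)

section \<open>Correctness of the system of equations\<close>

lemma solvable_eqns_iff: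
  assumes "length F = length Q"
    and F: "\<forall>p\<in>set F. \<forall>(e, c)\<in>set p. length e = n"
    and Q: "\<forall>p\<in>set Q. \<forall>(e, q)\<in>set p. length e = n"
  shows "solvable d (eqns F Q) \<longleftrightarrow>
    (\<exists>ts. length ts = d \<and> (\<forall>j<length F. \<forall>xs. length xs = n \<longrightarrow>
       ev (F ! j) xs = ev (map (\<lambda>(e, q). (e, ev q ts)) (Q ! j)) xs))"
proof -
  have "(\<forall>e\<in>set (eqns F Q). ev e ts = 0) \<longleftrightarrow>
      (\<forall>j<length F. \<forall>xs. length xs = n \<longrightarrow>
        ev (F ! j) xs = ev (map (\<lambda>(e, q). (e, ev q ts)) (Q ! j)) xs)" for ts
  proof -
    have "(\<forall>e\<in>set (eqns F Q). ev e ts = 0) \<longleftrightarrow>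
        (\<forall>j<length F. \<forall>e\<in>fst ` set (F ! j) \<union> fst ` set (Q ! j). ev (coef_eqn e (F ! j) (Q ! j)) ts = 0)"
      using assms(1) by (simp add: eqns_def set_zip image_Un) blast
    also have "\<dots> \<longleftrightarrow> (\<forall>j<length F. \<forall>xs. length xs = n \<longrightarrow>
        ev (F ! j) xs = ev (map (\<lambda>(e, q). (e, ev q ts)) (Q ! j)) xs)"
    proof (intro all_cong1 imp_cong refl)
      fix j assume j: "j < length F"
      have "fst ` set (map (\<lambda>(e, q). (e, ev q ts)) (Q ! j)) = fst ` set (Q ! j)"
        by (force simp: image_iff)
      moreover have "\<forall>(e, c)\<in>set (F ! j). length e = n"
        using bspec[OF F nth_mem] j by simp
      moreover have "\<forall>(e, c)\<in>set (map (\<lambda>(e, q). (e, ev q ts)) (Q ! j)). length e = n"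
        using Q j assms(1) by fastforce
      ultimately show "(\<forall>e\<in>fst ` set (F ! j) \<union> fst ` set (Q ! j). ev (coef_eqn e (F ! j) (Q ! j)) ts = 0)
          \<longleftrightarrow> (\<forall>xs. length xs = n \<longrightarrow>
            ev (F ! j) xs = ev (map (\<lambda>(e, q). (e, ev q ts)) (Q ! j)) xs)"
        by (subst ev_eq_iff_coefficients_eq) (simp_all add: ev_coef_eqn)
    qed
    finally show ?thesis .
  qed
  then show ?thesis
    by (simp add: solvable_iff)
qed

section \<open>Translation between vectors and lists of coordinates\<close>

lemma monomial_value_vec_of_list:
  "length e = length xs \<Longrightarrow> monomial_value e (vec_of_list xs) = mon e xs"
proof (induction e xs rule: list_induct2)
  case (Cons k e x xs)
  then show ?case
    by (simp add: monomial_value_def prod.lessThan_Suc_shift vec_of_list_index del: prod.lessThan_Suc)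
qed (simp add: monomial_value_def)

lemma poly_value_vec_of_list:
  "\<forall>(e, c)\<in>set p. length e = length xs \<Longrightarrow> poly_value p (vec_of_list xs) = ev p xs"
  by (induction p) (auto simp: poly_value_def monomial_value_vec_of_list)

lemma ball_carrier_vec: "(\<forall>x\<in>carrier_vec n. R x) \<longleftrightarrow> (\<forall>xs. length xs = n \<longrightarrow> R (vec_of_list xs))"
proof
  assume R: "\<forall>xs. length xs = n \<longrightarrow> R (vec_of_list xs)"
  show "\<forall>x\<in>carrier_vec n. R x"
  proof
    fix x :: "'a vec" assume "x \<in> carrier_vec n"
    then show "R x"
      using R[rule_format, of "list_of_vec x"] by (simp add: vec_list)
  qed
next
  assume R: "\<forall>x\<in>carrier_vec n. R x"
  show "\<forall>xs. length xs = n \<longrightarrow> R (vec_of_list xs)"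
    by (intro allI impI bspec[OF R] carrier_vecI) simp
qed

lemma cmap_of_eq_iff:
  assumes "length F = length G"
    and F: "\<forall>p\<in>set F. \<forall>(e, c)\<in>set p. length e = n"
    and G: "\<forall>p\<in>set G. \<forall>(e, q)\<in>set p. length e = n"
  shows "cmap_of n F = cmap_of n G \<longleftrightarrow>
    (\<forall>j<length F. \<forall>xs. length xs = n \<longrightarrow> ev (F ! j) xs = ev (G ! j) xs)"
proof -
  have "cmap_of n F = cmap_of n G \<longleftrightarrow> (\<forall>x\<in>carrier_vec n.
      vec (length F) (\<lambda>j. poly_value (F ! j) x) = vec (length G) (\<lambda>j. poly_value (G ! j) x))"
    unfolding cmap_of_def by (auto simp: fun_eq_iff restrict_def)
  also have "\<dots> \<longleftrightarrow> (\<forall>x\<in>carrier_vec n. \<forall>j<length F. poly_value (F ! j) x = poly_value (G ! j) x)"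
    using assms(1) by (auto simp: vec_eq_iff)
  also have "\<dots> \<longleftrightarrow> (\<forall>xs. length xs = n \<longrightarrow> (\<forall>j<length F. ev (F ! j) xs = ev (G ! j) xs))"
    unfolding ball_carrier_vec
  proof (intro all_cong1 imp_cong refl)
    fix xs :: "complex list" and j assume j: "length xs = n" "j < length F"
    have "\<forall>(e, c)\<in>set (F ! j). length e = length xs" "\<forall>(e, c)\<in>set (G ! j). length e = length xs"
      using bspec[OF F nth_mem] bspec[OF G nth_mem] j assms(1) by simp_all
    then show "poly_value (F ! j) (vec_of_list xs) = poly_value (G ! j) (vec_of_list xs) \<longleftrightarrow>
        ev (F ! j) xs = ev (G ! j) xs"
      by (simp add: poly_value_vec_of_list)
  qed
  finally show ?thesis
    by blast
qed

section \<open>Parameter spaces in coordinates\<close>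

context complex_vector_space
begin

lemma is_basis_coordinates:
  assumes "is_basis bs W"
  shows "W = (\<lambda>t. \<Sum>i<length bs. scale (t $ i) (bs ! i)) ` carrier_vec (length bs)"
proof (intro equalityI subsetI)
  fix w assume "w \<in> W"
  then obtain u where "w = (\<Sum>v\<in>set bs. scale (u v) v)"
    using assms by (auto simp: is_basis_def span_finite)
  also have "\<dots> = (\<Sum>i<length bs. scale (u (bs ! i)) (bs ! i))"
    using assms by (intro sum.reindex_bij_betw[symmetric] bij_betw_nth) (auto simp: is_basis_def)
  finally have "w = (\<Sum>i<length bs. scale (vec (length bs) (\<lambda>i. u (bs ! i)) $ i) (bs ! i))"
    by simp
  then show "w \<in> (\<lambda>t. \<Sum>i<length bs. scale (t $ i) (bs ! i)) ` carrier_vec (length bs)"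
    by (rule image_eqI) simp
next
  fix w assume "w \<in> (\<lambda>t. \<Sum>i<length bs. scale (t $ i) (bs ! i)) ` carrier_vec (length bs)"
  moreover have "(\<Sum>i<length bs. scale (t $ i) (bs ! i)) \<in> span (set bs)" for t
    by (intro span_sum span_scale span_base) simp
  ultimately show "w \<in> W"
    using assms by (auto simp: is_basis_def)
qed

text \<open>A basis replaces the parameter by a coordinate vector, and equality of mappings amounts
  to equality of coefficients, which are polynomials in these coordinates. The degree bounds
  \<open>k\<close> and \<open>K\<close> may differ.\<close>

lemma in_image_iff_solvable:
  assumes \<Phi>: "presents_family n m K W \<Phi> bs Q" and f: "presents_cmap n m k F f"
  shows "f \<in> \<Phi> ` W \<longleftrightarrow> solvable (length bs) (eqns F Q)"
proof -
  have F: "length F = length Q" "\<forall>p\<in>set F. \<forall>(e, c)\<in>set p. length e = n" "f = cmap_of n F"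
    using f \<Phi> by (auto simp: presents_cmap_def presents_family_def wf_family_def terms_in_def)
  have Q: "\<forall>p\<in>set Q. \<forall>(e, q)\<in>set p. length e = n \<and> (\<forall>(e', c)\<in>set q. length e' = length bs)"
    using \<Phi> by (fastforce simp: presents_family_def wf_family_def terms_in_def)
  define G where "G = (\<lambda>ts. map (map (\<lambda>(e, q). (e, ev q ts))) Q)"
  have G: "specialize (vec_of_list ts) Q = G ts" if "length ts = length bs" for ts
    using Q that unfolding specialize_def G_def by (fastforce simp: poly_value_vec_of_list)
  have "f \<in> \<Phi> ` W \<longleftrightarrow> (\<exists>t\<in>carrier_vec (length bs). cmap_of n F = cmap_of n (specialize t Q))"
  proof -
    have "W = (\<lambda>t. \<Sum>i<length bs. scale (t $ i) (bs ! i)) ` carrier_vec (length bs)"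
      using \<Phi> by (intro is_basis_coordinates) (simp add: presents_family_def)
    moreover have "\<forall>t\<in>carrier_vec (length bs).
        \<Phi> (\<Sum>i<length bs. scale (t $ i) (bs ! i)) = cmap_of n (specialize t Q)"
      using \<Phi> by (simp add: presents_family_def)
    ultimately show ?thesis
      using F(3) by (auto simp: image_iff)
  qed
  also have "\<dots> \<longleftrightarrow> (\<exists>ts. length ts = length bs \<and> cmap_of n F = cmap_of n (G ts))"
    \<comment> \<open>The existential form follows by negating the universal one.\<close>
    using ball_carrier_vec[of "length bs" "\<lambda>t. cmap_of n F \<noteq> cmap_of n (specialize t Q)"] G by metis
  also have "\<dots> \<longleftrightarrow> (\<exists>ts. length ts = length bs \<and> (\<forall>j<length F. \<forall>xs. length xs = n \<longrightarrow>
      ev (F ! j) xs = ev (G ts ! j) xs))"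
    using Q F by (subst cmap_of_eq_iff) (fastforce simp: G_def)+
  also have "\<dots> \<longleftrightarrow> solvable (length bs) (eqns F Q)"
    using Q F by (subst solvable_eqns_iff[of F Q n]) (fastforce simp: G_def)+
  finally show ?thesis .
qed

end

section \<open>The search for the complexity\<close>

lemma code_list_enc: "code_list enc = enc"
  by (simp add: enc_list_def)

text \<open>The prescribed input codes agree with \<open>enc\<close>, so programs for computable
  functions run on the actual inputs.\<close>

lemma code_terms_enc: "code_terms enc = (enc :: 'c::encodable terms \<Rightarrow> data)"
proof -
  have "(\<lambda>(e, c). Node (code_list code_nat e) (enc c)) = (enc :: nat list \<times> 'c \<Rightarrow> data)"
    by (auto simp: fun_eq_iff enc_list_def enc_nat_def)
  then show ?thesis
    by (simp add: code_terms_def enc_list_def)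
qed

lemma code_cmap_enc: "code_cmap n m F = enc (n, m, F)"
  using code_terms_enc[where 'c = complex] code_list_enc[where 'a = "complex terms"]
  by (simp add: code_cmap_def code_nat_def enc_complex_def)

lemma complexity_source_enc:
  "complexity_source A d K Q \<alpha> = (if \<alpha> \<in> A then enc (d \<alpha>, K \<alpha>, Q \<alpha>) else Null)"
  using code_terms_enc[where 'c = complex] code_terms_enc[where 'c = "complex terms"]
    code_list_enc[where 'a = "complex terms terms"]
  by (simp add: complexity_source_def code_nat_def enc_complex_def)

text \<open>The negation is the condition for continuing the search. The argument pairs the whole
  input with the answer to one query, so neither has to be repacked.\<close>

definition not_member :: "(nat \<times> nat \<times> complex terms list) \<times>
    (nat \<times> nat \<times> complex terms terms list) \<Rightarrow> bool" where
  "not_member z \<longleftrightarrow> \<not> solvable (fst (snd z)) (eqns (snd (snd (fst z))) (snd (snd (snd z))))"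

lemma computable_not_member: "computable not_member"
  unfolding not_member_def by (intro computable_intros)

theorem theorem5p1:
  "\<exists>p. \<forall>(scale :: complex \<Rightarrow> 'v::ab_group_add \<Rightarrow> 'v) n m A V K P bs Q f k F.
     polynomial_type_complexity scale n m A V K P \<longrightarrow>
     (\<forall>\<alpha>\<in>A. complex_vector_space.presents_family scale n m (K \<alpha>) (V \<alpha>) (P \<alpha>) (bs \<alpha>) (Q \<alpha>)) \<longrightarrow>
     f \<in> Pol n m \<longrightarrow>
     presents_cmap n m k F f \<longrightarrow>
     f \<in> (\<Union>\<alpha>\<in>A. P \<alpha> ` V \<alpha>) \<longrightarrow>
     run (complexity_source A (\<lambda>\<alpha>. length (bs \<alpha>)) K Q) p (code_cmap n m F)
       (code_nat (complexity A V P f))"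
proof -
  obtain dec where dec: "\<And>src z. run src dec (enc z) (enc (not_member z))"
    using computable_not_member unfolding computable_def by blast
  define query where "query = Seq Second Query"
  \<comment> \<open>Outside \<open>A\<close> the answer is \<open>Null\<close>, and the search has
    to go on, whence \<open>MkOne\<close>.\<close>
  define test where "test = Cond (Seq query IsNull) MkOne (Seq (Fork First query) dec)"
  define body where "body = Fork First (Seq (Fork Second MkOne) Add)"
  \<comment> \<open>The loop state pairs the input with the current candidate, initially 0; the last
    candidate is the output.\<close>
  define p where "p = Seq (Fork Skip MkZero) (Seq (While test body) Second)"
  show ?thesis
  proof (intro exI[of _ p] allI impI)
    fix scale :: "complex \<Rightarrow> 'v \<Rightarrow> 'v" and n m A V K P bs Q f k F
    assume C: "polynomial_type_complexity scale n m A V K P"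
      and fam: "\<forall>\<alpha>\<in>A. complex_vector_space.presents_family scale n m (K \<alpha>) (V \<alpha>) (P \<alpha>) (bs \<alpha>) (Q \<alpha>)"
      and F: "presents_cmap n m k F f"
      and f: "f \<in> (\<Union>\<alpha>\<in>A. P \<alpha> ` V \<alpha>)"
    interpret polynomial_type_complexity scale n m A V K P
      by (rule C)
    define src where "src = complexity_source A (\<lambda>\<alpha>. length (bs \<alpha>)) K Q"
    define \<gamma> where "\<gamma> = complexity A V P f"
    have member: "f \<in> P \<alpha> ` V \<alpha> \<longleftrightarrow> \<not> not_member ((n, m, F), (length (bs \<alpha>), K \<alpha>, Q \<alpha>))"
      if "\<alpha> \<in> A" for \<alpha>
      using in_image_iff_solvable[OF fam[rule_format, OF that] F] by (simp add: not_member_def)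
    have query: "run src query (Node (enc (n, m, F)) (Num (of_nat \<alpha>))) (src \<alpha>)" for \<alpha>
      unfolding query_def by (rule run.Seq[OF run.Second run.Query])
    have test: "run src test (Node (enc (n, m, F)) (Num (of_nat \<alpha>)))
        (Num (if \<alpha> \<in> A \<and> f \<in> P \<alpha> ` V \<alpha> then 0 else 1))" for \<alpha>
    proof (cases "\<alpha> \<in> A")
      case False
      then have "run src (Seq query IsNull) (Node (enc (n, m, F)) (Num (of_nat \<alpha>))) (Num 1)"
        using run.Seq[OF query[of \<alpha>] run.IsNull] by (simp add: src_def complexity_source_enc)
      from run.CondTrue[OF this _ run.MkOne] False show ?thesis
        by (simp add: test_def)
    next
      case True
      then have src: "src \<alpha> = enc (length (bs \<alpha>), K \<alpha>, Q \<alpha>)"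
        by (simp add: src_def complexity_source_enc)
      \<comment> \<open>The code of a triple is a \<open>Node\<close> and hence never mistaken for
        \<open>Null\<close>.\<close>
      then have 0: "run src (Seq query IsNull) (Node (enc (n, m, F)) (Num (of_nat \<alpha>))) (Num 0)"
        using run.Seq[OF query[of \<alpha>] run.IsNull] by simp
      have "run src (Fork First query) (Node (enc (n, m, F)) (Num (of_nat \<alpha>)))
          (enc ((n, m, F), (length (bs \<alpha>), K \<alpha>, Q \<alpha>)))"
        using run.Fork[OF run.First query[of \<alpha>]] by (simp add: src)
      from run.Seq[OF this dec] have "run src (Seq (Fork First query) dec)
          (Node (enc (n, m, F)) (Num (of_nat \<alpha>))) (Num (if \<alpha> \<in> A \<and> f \<in> P \<alpha> ` V \<alpha> then 0 else 1))"
        using True by (cases "f \<in> P \<alpha> ` V \<alpha>") (simp_all add: member)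
      then show ?thesis
        unfolding test_def by (rule run.CondFalse[OF 0])
    qed
    have body: "run src body (Node x (Num (of_nat \<alpha>))) (Node x (Num (of_nat (Suc \<alpha>))))" for x \<alpha>
      using run.Fork[OF run.First run.Seq[OF run.Fork[OF run.Second run.MkOne] run.Add]]
      by (simp add: body_def add.commute[of 1])
    have "\<exists>\<alpha>. \<alpha> \<in> A \<and> f \<in> P \<alpha> ` V \<alpha>"
      using f by auto
    then have \<gamma>: "\<gamma> \<in> A \<and> f \<in> P \<gamma> ` V \<gamma>"
      unfolding \<gamma>_def complexity_def by (rule LeastI_ex)
    have least: "\<not> (\<alpha> \<in> A \<and> f \<in> P \<alpha> ` V \<alpha>)" if "\<alpha> < \<gamma>" for \<alpha>
      using that unfolding \<gamma>_def complexity_def by (rule not_less_Least)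
    \<comment> \<open>Downward induction from \<gamma>: there the test yields 0, and below it
      minimality makes the test yield 1.\<close>
    have loop: "run src (While test body) (Node (enc (n, m, F)) (Num (of_nat \<alpha>)))
        (Node (enc (n, m, F)) (Num (of_nat \<gamma>)))" if "\<alpha> \<le> \<gamma>" for \<alpha>
      using that
    proof (induction rule: inc_induct)
      case base
      then show ?case
        using test[of \<gamma>] \<gamma> by (intro run.WhileFalse) simp
    next
      case (step \<alpha>)
      have "run src test (Node (enc (n, m, F)) (Num (of_nat \<alpha>))) (Num 1)"
        using test[of \<alpha>] least[OF step.hyps(2)] by (simp del: de_Morgan_conj)
      then show ?case
        by (rule run.WhileTrue[OF _ _ body step.IH]) simp
    qed
    have "run src p (enc (n, m, F)) (Num (of_nat \<gamma>))"
      unfolding p_def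
      using run.Fork[OF run.Skip run.MkZero] loop[of 0] run.Second
      by (intro run.Seq) auto
    then show "run (complexity_source A (\<lambda>\<alpha>. length (bs \<alpha>)) K Q) p (code_cmap n m F)
        (code_nat (complexity A V P f))"
      by (simp only: src_def \<gamma>_def code_cmap_enc code_nat_def)
  qed
qed

end
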